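(* Let $\mathbf{G}$ be a spray of scalar curvature with Riemann curvature $R^i_{\ k}=R\delta^i_k-\tau_ky^i$, and let $Q$ be a Funk function of $\mathbf{G}$. Then $R$, $\tau_k$ and $Q$ are related by $$R\,Q_{.k}=Q\,\tau_k .$$ (i) If $\mathbf{G}$ is of isotropic curvature with $R\neq0$, then $Q^2=cR$, where $c=c(x)$ is a scalar function. (ii) If $\mathbf{G}$ is of constant curvature with $R\neq0$, then $Q$ is a closed $1$-form. In this case, if $Q\neq0$, then for some scalar function $\sigma=\sigma(x)$, $$Q=\sigma_0,\qquad R=\pm\big[(e^{-\sigma})_0\big]^2,\qquad Q^2=\pm e^{2\sigma}R .$$
   Context: A spray on a manifold $M$ is a smooth vector field on a conical region of $TM\setminus\{0\}$ (an open set closed under $y\mapsto\lambda y$, $\lambda>0$), locally $\mathbf{G}=y^i\frac{\partial}{\partial x^i}-2G^i\frac{\partial}{\partial y^i}$ with $G^i$ positively homogeneous of degree two in $y$. Put $\partial_k=\partial/\partial x^k$, $\dot\partial_k=\partial/\partial y^k$, $G^r_i=\dot\partial_iG^r$, $G^r_{ij}=\dot\partial_j\dot\partial_iG^r$, $\delta_i=\partial_i-G^r_i\dot\partial_r$. For a function $f$: $f_{.i}=\dot\partial_if$, $f_{;i}=\delta_if$; for $T_i$: $T_{i;j}=\delta_jT_i-T_rG^r_{ij}$. Riemann curvature: $R^i_{\ k}=2\partial_kG^i-y^j\partial_j\dot\partial_kG^i+2G^j\dot\partial_j\dot\partial_kG^i-(\dot\partial_jG^i)(\dot\partial_kG^j)$.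 Scalar curvature: $R^i_{\ k}=R\delta^i_k-\tau_ky^i$ for some homogeneous functions $R(x,y),\tau_k(x,y)$. Isotropic curvature: moreover $R_{.i}=2\tau_i$. Constant curvature: scalar curvature with $\tau_{i;k}=0$ (equivalently, either $R=0$ and $\tau_k=0$, or $R_{;i}=0$). A Funk function of $\mathbf{G}$ is a function $Q$, positively homogeneous of degree one in $y$, with $Q_{;k}=QQ_{.k}$. A function $Q(x,y)=b_i(x)y^i$ is identified with the $1$-form $b_i\,dx^i$. For a scalar function $f=f(x)$ on $M$, $f_0:=f_{x^i}y^i$; in particular $\sigma_0=\sigma_{x^i}y^i$ and $(e^{-\sigma})_0=(e^{-\sigma})_{x^i}y^i$. The signs $\pm$ in the last display agree.
   Formalization: Parts (i) and (ii) are proved on every conical subregion where R vanishes nowhere and whose fibres over points of M are connected; the last display also assumes that the subregion projects onto a connected subset of M. Without these conditions the claims can fail. *)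

theory Defs
  imports "HOL-Analysis.Analysis"
begin

section \<open>Smooth functions on open subsets of Euclidean spaces\<close>

fun Ck_on :: "nat \<Rightarrow> 'a set \<Rightarrow> ('a::euclidean_space \<Rightarrow> 'b::real_normed_vector) \<Rightarrow> bool" where
  "Ck_on 0 S f \<longleftrightarrow> continuous_on S f"
| "Ck_on (Suc k) S f \<longleftrightarrow>
     (\<forall>x\<in>S. f differentiable (at x)) \<and> (\<forall>h. Ck_on k S (\<lambda>x. frechet_derivative f (at x) h))"

text \<open>Only used for open \<open>S\<close>.\<close>

definition smooth_on :: "'a set \<Rightarrow> ('a::euclidean_space \<Rightarrow> 'b::real_normed_vector) \<Rightarrow> bool" where
  "smooth_on S f \<longleftrightarrow> (\<forall>k. Ck_on k S f)"


section \<open>Manifolds\<close>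

text \<open>
  The manifold \<open>M\<close> is the whole type \<open>'m\<close>, its dimension is \<open>CARD('n)\<close>. A chart is a pair of
  its domain and its coordinate map; the coordinate map is irrelevant outside the domain.
\<close>

type_synonym ('m, 'n) chart = "'m set \<times> ('m \<Rightarrow> real^'n)"

abbreviation chart_inv :: "('m, 'n) chart \<Rightarrow> real^'n \<Rightarrow> 'm" where
  "chart_inv \<phi> \<equiv> inv_into (fst \<phi>) (snd \<phi>)"

abbreviation transition :: "('m, 'n) chart \<Rightarrow> ('m, 'n) chart \<Rightarrow> real^'n \<Rightarrow> real^'n" where
  "transition \<phi> \<psi> \<equiv> snd \<psi> \<circ> chart_inv \<phi>"

definition smooth_atlas ::
    "('m::{t2_space, second_countable_topology}, 'n::finite) chart set \<Rightarrow> bool" where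
  "smooth_atlas A \<longleftrightarrow>
     (\<Union>\<phi>\<in>A. fst \<phi>) = UNIV \<and>
     (\<forall>\<phi>\<in>A. open (fst \<phi>) \<and> open (snd \<phi> ` fst \<phi>) \<and>
        homeomorphism (fst \<phi>) (snd \<phi> ` fst \<phi>) (snd \<phi>) (chart_inv \<phi>)) \<and>
     (\<forall>\<phi>\<in>A. \<forall>\<psi>\<in>A. smooth_on (snd \<phi> ` (fst \<phi> \<inter> fst \<psi>)) (transition \<phi> \<psi>))"

definition smooth_fun_on ::
    "('m, 'n::finite) chart set \<Rightarrow> 'm set \<Rightarrow> ('m \<Rightarrow> real) \<Rightarrow> bool" where
  "smooth_fun_on A S f \<longleftrightarrow> (\<forall>\<phi>\<in>A. smooth_on (snd \<phi> ` (fst \<phi> \<inter> S)) (f \<circ> chart_inv \<phi>))"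


section \<open>The tangent bundle\<close>

text \<open>
  A tangent vector at \<open>p\<close> is the family of its components with respect to the charts of the atlas
  around \<open>p\<close>, which are related by the Jacobian matrices of the transition maps. The value \<open>0\<close> at
  all other charts makes the family unique.
\<close>

type_synonym ('m, 'n) tvec = "'m \<times> (('m, 'n) chart \<Rightarrow> real^'n)"

definition tangent_bundle :: "('m, 'n::finite) chart set \<Rightarrow> ('m, 'n) tvec set" where
  "tangent_bundle A = {(p, v).
     (\<forall>\<phi>\<in>A. \<forall>\<psi>\<in>A. p \<in> fst \<phi> \<inter> fst \<psi> \<longrightarrow>
        v \<psi> = frechet_derivative (transition \<phi> \<psi>) (at (snd \<phi> p)) (v \<phi>)) \<and>
     (\<forall>\<phi>. \<not> (\<phi> \<in> A \<and> p \<in> fst \<phi>) \<longrightarrow> v \<phi> = 0)}"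

definition scale_tvec :: "real \<Rightarrow> ('m, 'n::finite) tvec \<Rightarrow> ('m, 'n) tvec" where
  "scale_tvec t = (\<lambda>(p, v). (p, \<lambda>\<phi>. t *\<^sub>R v \<phi>))"

text \<open>The coordinates \<open>(x, y)\<close> that a chart \<open>\<phi>\<close> induces on the part of \<open>TM\<close> over its domain.\<close>

definition coords :: "('m, 'n) chart \<Rightarrow> ('m, 'n) tvec \<Rightarrow> (real^'n) \<times> (real^'n)" where
  "coords \<phi> = (\<lambda>(p, v). (snd \<phi> p, v \<phi>))"

definition coords_inv ::
    "('m, 'n::finite) chart set \<Rightarrow> ('m, 'n) chart \<Rightarrow> (real^'n) \<times> (real^'n) \<Rightarrow> ('m, 'n) tvec" where
  "coords_inv A \<phi> = inv_into {w \<in> tangent_bundle A. fst w \<in> fst \<phi>} (coords \<phi>)"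

definition coord_image ::
    "('m, 'n) chart \<Rightarrow> ('m, 'n) tvec set \<Rightarrow> ((real^'n) \<times> (real^'n)) set" where
  "coord_image \<phi> C = coords \<phi> ` {w \<in> C. fst w \<in> fst \<phi>}"

text \<open>The expression \<open>f(x, y)\<close> in a chart of a function \<open>f\<close> on (a part of) \<open>TM\<close>.\<close>

definition local_expr ::
    "('m, 'n::finite) chart set \<Rightarrow> ('m, 'n) chart \<Rightarrow> (('m, 'n) tvec \<Rightarrow> real)
      \<Rightarrow> (real^'n) \<times> (real^'n) \<Rightarrow> real" where
  "local_expr A \<phi> f = f \<circ> coords_inv A \<phi>"

definition conical_region :: "('m, 'n::finite) chart set \<Rightarrow> ('m, 'n) tvec set \<Rightarrow> bool" where
  "conical_region A C \<longleftrightarrow>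
     C \<subseteq> tangent_bundle A - {(p, \<lambda>\<phi>. 0) | p. True} \<and>
     (\<forall>\<phi>\<in>A. open (coord_image \<phi> C)) \<and>
     (\<forall>w\<in>C. \<forall>t>0. scale_tvec t w \<in> C)"

definition connected_fibres :: "('m, 'n::finite) chart set \<Rightarrow> ('m, 'n) tvec set \<Rightarrow> bool" where
  "connected_fibres A C \<longleftrightarrow> (\<forall>\<phi>\<in>A. \<forall>x. connected {y. (x, y) \<in> coord_image \<phi> C})"

text \<open>
  A vector field on \<open>C\<close> is given by its components in the induced coordinates on \<open>TM\<close>, which
  transform by the differential of the coordinate change.
\<close>

definition smooth_vector_field_on ::
    "('m, 'n::finite) chart set \<Rightarrow> ('m, 'n) tvec set
      \<Rightarrow> (('m, 'n) chart \<Rightarrow> (real^'n) \<times> (real^'n) \<Rightarrow> (real^'n) \<times> (real^'n)) \<Rightarrow> bool" where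
  "smooth_vector_field_on A C X \<longleftrightarrow>
     (\<forall>\<phi>\<in>A. smooth_on (coord_image \<phi> C) (X \<phi>)) \<and>
     (\<forall>\<phi>\<in>A. \<forall>\<psi>\<in>A. \<forall>w\<in>C. fst w \<in> fst \<phi> \<inter> fst \<psi> \<longrightarrow>
        X \<psi> (coords \<psi> w) =
          frechet_derivative (coords \<psi> \<circ> coords_inv A \<phi>) (at (coords \<phi> w)) (X \<phi> (coords \<phi> w)))"

definition homogeneous_on ::
    "nat \<Rightarrow> ((real^'n) \<times> (real^'n)) set \<Rightarrow> ((real^'n) \<times> (real^'n) \<Rightarrow> real) \<Rightarrow> bool" where
  "homogeneous_on d S f \<longleftrightarrow> (\<forall>(x, y)\<in>S. \<forall>t>0. f (x, t *\<^sub>R y) = t ^ d * f (x, y))"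


section \<open>Coordinate calculus of sprays\<close>

text \<open>\<open>pdx k\<close> and \<open>pdy k\<close> are the partial derivatives with respect to \<open>x\<^sup>k\<close> and \<open>y\<^sup>k\<close>.\<close>

definition pdx :: "'n::finite \<Rightarrow> ((real^'n) \<times> (real^'n) \<Rightarrow> real) \<Rightarrow> (real^'n) \<times> (real^'n) \<Rightarrow> real" where
  "pdx k f z = frechet_derivative f (at z) (axis k 1, 0)"

definition pdy :: "'n::finite \<Rightarrow> ((real^'n) \<times> (real^'n) \<Rightarrow> real) \<Rightarrow> (real^'n) \<times> (real^'n) \<Rightarrow> real" where
  "pdy k f z = frechet_derivative f (at z) (0, axis k 1)"

text \<open>
  Below, \<open>G i\<close> is the local spray coefficient \<open>G\<^sup>i\<close>; \<open>hderiv G i f\<close> is \<open>f\<^sub>;\<^sub>i = \<delta>\<^sub>i f\<close> and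
  \<open>hderiv_cov G T i j\<close> is \<open>T\<^sub>i\<^sub>;\<^sub>j\<close>.
\<close>

definition hderiv ::
    "('n::finite \<Rightarrow> (real^'n) \<times> (real^'n) \<Rightarrow> real) \<Rightarrow> 'n
      \<Rightarrow> ((real^'n) \<times> (real^'n) \<Rightarrow> real) \<Rightarrow> (real^'n) \<times> (real^'n) \<Rightarrow> real" where
  "hderiv G i f z = pdx i f z - (\<Sum>r\<in>UNIV. pdy i (G r) z * pdy r f z)"

definition hderiv_cov ::
    "('n::finite \<Rightarrow> (real^'n) \<times> (real^'n) \<Rightarrow> real)
      \<Rightarrow> ('n \<Rightarrow> (real^'n) \<times> (real^'n) \<Rightarrow> real) \<Rightarrow> 'n \<Rightarrow> 'n \<Rightarrow> (real^'n) \<times> (real^'n) \<Rightarrow> real" where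
  "hderiv_cov G T i j z =
     hderiv G j (T i) z - (\<Sum>r\<in>UNIV. T r z * pdy j (pdy i (G r)) z)"

definition riemann ::
    "('n::finite \<Rightarrow> (real^'n) \<times> (real^'n) \<Rightarrow> real) \<Rightarrow> 'n \<Rightarrow> 'n \<Rightarrow> (real^'n) \<times> (real^'n) \<Rightarrow> real" where
  "riemann G i k z =
     2 * pdx k (G i) z
     - (\<Sum>j\<in>UNIV. snd z $ j * pdx j (pdy k (G i)) z)
     + 2 * (\<Sum>j\<in>UNIV. G j z * pdy j (pdy k (G i)) z)
     - (\<Sum>j\<in>UNIV. pdy j (G i) z * pdy k (G j) z)"


section \<open>Sprays, their curvature, and Funk functions\<close>

definition spray ::
    "('m, 'n::finite) chart set \<Rightarrow> ('m, 'n) tvec set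
      \<Rightarrow> (('m, 'n) chart \<Rightarrow> 'n \<Rightarrow> (real^'n) \<times> (real^'n) \<Rightarrow> real) \<Rightarrow> bool" where
  "spray A C G \<longleftrightarrow>
     conical_region A C \<and>
     smooth_vector_field_on A C (\<lambda>\<phi> z. (snd z, (\<chi> i. - 2 * G \<phi> i z))) \<and>
     (\<forall>\<phi>\<in>A. \<forall>i. homogeneous_on 2 (coord_image \<phi> C) (G \<phi> i))"

text \<open>
  The components \<open>\<tau>\<^sub>k\<close> are given chartwise; they transform as a covector, because \<open>R\<^sup>i\<^sub>k\<close> is a
  tensor, \<open>R\<close> is a function on \<open>C\<close> and \<open>y\<close> does not vanish. The degrees of homogeneity are those
  forced by the degree two of \<open>R\<^sup>i\<^sub>k\<close> (in dimension at least two).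
\<close>

definition scalar_curvature ::
    "('m, 'n::finite) chart set \<Rightarrow> ('m, 'n) tvec set
      \<Rightarrow> (('m, 'n) chart \<Rightarrow> 'n \<Rightarrow> (real^'n) \<times> (real^'n) \<Rightarrow> real)
      \<Rightarrow> (('m, 'n) tvec \<Rightarrow> real)
      \<Rightarrow> (('m, 'n) chart \<Rightarrow> 'n \<Rightarrow> (real^'n) \<times> (real^'n) \<Rightarrow> real) \<Rightarrow> bool" where
  "scalar_curvature A C G R \<tau> \<longleftrightarrow>
     (\<forall>\<phi>\<in>A.
        smooth_on (coord_image \<phi> C) (local_expr A \<phi> R) \<and>
        homogeneous_on 2 (coord_image \<phi> C) (local_expr A \<phi> R) \<and>
        (\<forall>k. smooth_on (coord_image \<phi> C) (\<tau> \<phi> k) \<and> homogeneous_on 1 (coord_image \<phi> C) (\<tau> \<phi> k)) \<and>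
        (\<forall>z\<in>coord_image \<phi> C. \<forall>i k.
           riemann (G \<phi>) i k z =
             local_expr A \<phi> R z * (if i = k then 1 else 0) - \<tau> \<phi> k z * snd z $ i))"

definition isotropic_curvature ::
    "('m, 'n::finite) chart set \<Rightarrow> ('m, 'n) tvec set
      \<Rightarrow> (('m, 'n) chart \<Rightarrow> 'n \<Rightarrow> (real^'n) \<times> (real^'n) \<Rightarrow> real)
      \<Rightarrow> (('m, 'n) tvec \<Rightarrow> real)
      \<Rightarrow> (('m, 'n) chart \<Rightarrow> 'n \<Rightarrow> (real^'n) \<times> (real^'n) \<Rightarrow> real) \<Rightarrow> bool" where
  "isotropic_curvature A C G R \<tau> \<longleftrightarrow>
     scalar_curvature A C G R \<tau> \<and>
     (\<forall>\<phi>\<in>A. \<forall>z\<in>coord_image \<phi> C. \<forall>i. pdy i (local_expr A \<phi> R) z = 2 * \<tau> \<phi> i z)"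

definition constant_curvature ::
    "('m, 'n::finite) chart set \<Rightarrow> ('m, 'n) tvec set
      \<Rightarrow> (('m, 'n) chart \<Rightarrow> 'n \<Rightarrow> (real^'n) \<times> (real^'n) \<Rightarrow> real)
      \<Rightarrow> (('m, 'n) tvec \<Rightarrow> real)
      \<Rightarrow> (('m, 'n) chart \<Rightarrow> 'n \<Rightarrow> (real^'n) \<times> (real^'n) \<Rightarrow> real) \<Rightarrow> bool" where
  "constant_curvature A C G R \<tau> \<longleftrightarrow>
     scalar_curvature A C G R \<tau> \<and>
     (\<forall>\<phi>\<in>A. \<forall>z\<in>coord_image \<phi> C. \<forall>i k. hderiv_cov (G \<phi>) (\<tau> \<phi>) i k z = 0)"

definition funk_function ::
    "('m, 'n::finite) chart set \<Rightarrow> ('m, 'n) tvec set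
      \<Rightarrow> (('m, 'n) chart \<Rightarrow> 'n \<Rightarrow> (real^'n) \<times> (real^'n) \<Rightarrow> real)
      \<Rightarrow> (('m, 'n) tvec \<Rightarrow> real) \<Rightarrow> bool" where
  "funk_function A C G Q \<longleftrightarrow>
     (\<forall>\<phi>\<in>A.
        smooth_on (coord_image \<phi> C) (local_expr A \<phi> Q) \<and>
        homogeneous_on 1 (coord_image \<phi> C) (local_expr A \<phi> Q) \<and>
        (\<forall>z\<in>coord_image \<phi> C. \<forall>k.
           hderiv (G \<phi>) k (local_expr A \<phi> Q) z =
             local_expr A \<phi> Q z * pdy k (local_expr A \<phi> Q) z))"

text \<open>
  \<open>Q\<close>, restricted to \<open>D\<close>, is \<open>b\<^sub>i(x)y\<^sup>i\<close> for a closed 1-form \<open>b\<^sub>i dx\<^sup>i\<close> on the projection of \<open>D\<close>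
  to \<open>M\<close>. The local \<open>b\<close> are uniquely determined, hence patch together, since the fibres of a
  conical region are open.
\<close>

definition closed_one_form_on ::
    "('m, 'n::finite) chart set \<Rightarrow> ('m, 'n) tvec set \<Rightarrow> (('m, 'n) tvec \<Rightarrow> real) \<Rightarrow> bool" where
  "closed_one_form_on A D Q \<longleftrightarrow>
     (\<forall>\<phi>\<in>A. \<exists>b :: real^'n \<Rightarrow> real^'n.
        smooth_on (snd \<phi> ` (fst \<phi> \<inter> fst ` D)) b \<and>
        (\<forall>(x, y)\<in>coord_image \<phi> D. local_expr A \<phi> Q (x, y) = (\<Sum>i\<in>UNIV. b x $ i * y $ i)) \<and>
        (\<forall>x\<in>snd \<phi> ` (fst \<phi> \<inter> fst ` D). \<forall>i j.
           frechet_derivative b (at x) (axis j 1) $ i = frechet_derivative b (at x) (axis i 1) $ j))"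

text \<open>\<open>f\<^sub>0 = f\<^bsub>x\<^sup>i\<^esub> y\<^sup>i\<close>, computed in the chart \<open>\<phi>\<close>.\<close>

definition total_deriv ::
    "('m, 'n::finite) chart \<Rightarrow> ('m \<Rightarrow> real) \<Rightarrow> ('m, 'n) tvec \<Rightarrow> real" where
  "total_deriv \<phi> f = (\<lambda>(p, v).
     \<Sum>i\<in>UNIV. frechet_derivative (f \<circ> chart_inv \<phi>) (at (snd \<phi> p)) (axis i 1) * v \<phi> $ i)"

end

theory Submission
  imports Defs
begin

text \<open>
  All relations come from commuting horizontal derivatives. For every smooth function \<open>f\<close> the
  contracted Ricci identity
  \<open>y\<^sup>l (\<delta>\<^sub>k \<delta>\<^sub>l f - \<delta>\<^sub>l \<delta>\<^sub>k f) = - R\<^sup>r\<^sub>k f\<^sub>.\<^sub>r\<close> holds (\<open>ricci_identity\<close>), so a function homogeneous of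
  degree \<open>d\<close> whose horizontal derivatives commute satisfies \<open>R f\<^sub>.\<^sub>k = d f \<tau>\<^sub>k\<close> on a spray of scalar
  curvature, by Euler's relation (\<open>curvature_of_commuting\<close>). Differentiating \<open>Q\<^sub>;\<^sub>k = Q Q\<^sub>.\<^sub>k\<close>
  shows that \<open>Q\<close> is such a function of degree one, and this is \<open>R Q\<^sub>.\<^sub>k = Q \<tau>\<^sub>k\<close>.

  Where \<open>R \<noteq> 0\<close> and \<open>R\<^sub>.\<^sub>k = 2 \<tau>\<^sub>k\<close>, that relation says that \<open>Q\<^sup>2 / R\<close> has vanishing vertical derivative
  (\<open>pdy_sq_ratio\<close>); connected fibres make it a function \<open>c(x)\<close>.

  In constant curvature \<open>R = \<tau>\<^sub>k y\<^sup>k\<close> gives \<open>R\<^sub>;\<^sub>k = 0\<close>, and the Ricci identity applied to \<open>R\<close>, which has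
  degree two, gives \<open>R\<^sub>.\<^sub>k = 2 \<tau>\<^sub>k\<close> wherever \<open>R \<noteq> 0\<close> (\<open>hderiv_R\<close>, \<open>pdy_R\<close>). So \<open>Q\<^sup>2 = c R\<close> is
  available, and taking horizontal derivatives on both sides gives \<open>\<partial>\<^sub>k c = 2 c Q\<^sub>.\<^sub>k\<close> (\<open>pdx_sq_ratio\<close>).
  Where \<open>c \<noteq> 0\<close> this makes \<open>Q\<^sub>.\<^sub>k\<close> a function of \<open>x\<close>; where \<open>c\<close> vanishes, \<open>Q\<close> vanishes on the whole
  fibre. Hence \<open>Q = b\<^sub>k(x) y\<^sup>k\<close> everywhere. The symmetry of \<open>\<delta>\<^sub>j Q\<^sub>.\<^sub>i\<close>, a consequence of the Funk
  equation (\<open>hderiv_pdy_Q_sym\<close>), is then the closedness of \<open>b\<close>.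

  Finally \<open>dc = 2 c b\<close> is a linear differential equation along every segment, so the zero set
  of \<open>c\<close> is open as well as closed (\<open>base_ratio_zero_nearby\<close>). On a connected base \<open>c\<close> thus has
  constant sign \<open>s\<close>, nonzero as soon as \<open>Q \<noteq> 0\<close> somewhere, and \<open>\<sigma> = ln (s c) / 2\<close> satisfies \<open>d\<sigma> = b\<close>.
  The formulas for \<open>Q\<close>, \<open>R\<close> and \<open>Q\<^sup>2\<close> follow.

  In a chart, \<open>sq_ratio\<close> is \<open>Q\<^sup>2 / R\<close>, \<open>base_ratio\<close> is \<open>c\<close> and \<open>form_coeff\<close> is \<open>b\<close>. Since \<open>Q\<^sup>2 / R\<close> is a
  function of tangent vectors, \<open>c\<close> also makes sense on the manifold (\<open>curvature_ratio\<close>), and there is no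
  gluing of local solutions.
\<close>

section \<open>Calculus of smooth functions\<close>

lemma Ck_on_imp_continuous: "Ck_on k S f \<Longrightarrow> continuous_on S f"
proof (cases k)
  case (Suc j)
  moreover assume "Ck_on k S f"
  ultimately show ?thesis
    by (auto intro!: continuous_at_imp_continuous_on dest: differentiable_imp_continuous_within)
qed auto

lemma Ck_on_Suc_imp: "Ck_on (Suc k) S f \<Longrightarrow> Ck_on k S f"
proof (induction k arbitrary: f)
  case 0
  then show ?case using Ck_on_imp_continuous by (metis Ck_on.simps(1))
next
  case (Suc k)
  then show ?case by (metis Ck_on.simps(2))
qed

lemma Ck_on_subset: "Ck_on k S f \<Longrightarrow> T \<subseteq> S \<Longrightarrow> Ck_on k T f"
  by (induction k arbitrary: f) (auto intro: continuous_on_subset)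

lemma Ck_on_local:
  assumes "open S" "\<And>x. x \<in> S \<Longrightarrow> \<exists>T. open T \<and> x \<in> T \<and> Ck_on k T f"
  shows "Ck_on k S f"
  using assms(2)
proof (induction k arbitrary: f)
  case 0
  show ?case
    unfolding Ck_on.simps
  proof (rule continuous_at_imp_continuous_on, rule ballI)
    fix x assume "x \<in> S"
    then obtain T where "open T" "x \<in> T" "continuous_on T f" using 0 by auto
    then show "isCont f x" by (simp add: continuous_on_eq_continuous_at)
  qed
next
  case (Suc k)
  have "f differentiable (at x)" if "x \<in> S" for x
    using Suc.prems[OF that] by auto
  moreover have "Ck_on k S (\<lambda>x. frechet_derivative f (at x) h)" for h
  proof (rule Suc.IH)
    fix x assume "x \<in> S"
    from Suc.prems[OF this] show "\<exists>T. open T \<and> x \<in> T \<and> Ck_on k T (\<lambda>x. frechet_derivative f (at x) h)"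
      by auto
  qed
  ultimately show ?case by simp
qed

lemma frechet_derivative_cong_open:
  assumes "open S" "x \<in> S" "\<And>x. x \<in> S \<Longrightarrow> f x = g x"
  shows "frechet_derivative f (at x) = frechet_derivative g (at x)"
proof -
  have "(f has_derivative D) (at x) \<longleftrightarrow> (g has_derivative D) (at x)" for D
    using has_derivative_transform_within_open[of f D x UNIV S g]
      has_derivative_transform_within_open[of g D x UNIV S f] assms by auto
  then show ?thesis by (simp add: frechet_derivative_def)
qed

lemma differentiable_cong_open:
  assumes "open S" "x \<in> S" "\<And>x. x \<in> S \<Longrightarrow> f x = g x" "f differentiable (at x)"
  shows "g differentiable (at x)"
  using assms has_derivative_transform_within_open[of f _ x UNIV S g]
  unfolding differentiable_def by blast

lemma Ck_on_cong:
  assumes "open S" "\<And>x. x \<in> S \<Longrightarrow> f x = g x" "Ck_on k S f"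
  shows "Ck_on k S g"
  using assms(2,3)
proof (induction k arbitrary: f g)
  case 0
  then show ?case using continuous_on_eq by (metis Ck_on.simps(1))
next
  case (Suc k)
  have "g differentiable (at x)" if "x \<in> S" for x
    using Suc.prems that by (auto intro: differentiable_cong_open[OF assms(1)])
  moreover have "Ck_on k S (\<lambda>x. frechet_derivative g (at x) h)" for h
  proof (rule Suc.IH)
    show "frechet_derivative f (at x) h = frechet_derivative g (at x) h" if "x \<in> S" for x
      using frechet_derivative_cong_open[OF assms(1) that, of f g] Suc.prems(1) by simp
    show "Ck_on k S (\<lambda>x. frechet_derivative f (at x) h)"
      using Suc.prems(2) by simp
  qed
  ultimately show ?case by simp
qed

text \<open>
  The recursive clause in terms of any family of derivatives, so that the differentiation rules can be
  used without mentioning \<open>frechet_derivative\<close> of a compound function.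
\<close>
lemma Ck_on_SucI:
  assumes "open S" "\<And>x. x \<in> S \<Longrightarrow> (f has_derivative D x) (at x)"
    and "\<And>h. Ck_on k S (\<lambda>x. D x h)"
  shows "Ck_on (Suc k) S f"
proof -
  have "frechet_derivative f (at x) = D x" if "x \<in> S" for x
    using assms(2)[OF that] frechet_derivative_at by metis
  then have "Ck_on k S (\<lambda>x. frechet_derivative f (at x) h)" for h
    by (intro Ck_on_cong[OF assms(1) _ assms(3)[of h]]) auto
  then show ?thesis using assms(2) by (auto simp: differentiable_def)
qed

lemma Ck_on_has_derivative:
  "Ck_on (Suc k) S f \<Longrightarrow> x \<in> S \<Longrightarrow> (f has_derivative frechet_derivative f (at x)) (at x)"
  by (simp add: frechet_derivative_works)

lemma Ck_on_const: "open S \<Longrightarrow> Ck_on k S (\<lambda>x. c)"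
proof (induction k arbitrary: c)
  case (Suc k)
  show ?case by (rule Ck_on_SucI[where D="\<lambda>x h. 0"]) (use Suc in auto)
qed auto

lemma Ck_on_add: "open S \<Longrightarrow> Ck_on k S f \<Longrightarrow> Ck_on k S g \<Longrightarrow> Ck_on k S (\<lambda>x. f x + g x)"
proof (induction k arbitrary: f g)
  case (Suc k)
  show ?case
    by (rule Ck_on_SucI[OF Suc.prems(1)])
      (use Suc in \<open>auto intro!: has_derivative_add simp: frechet_derivative_works\<close>)
qed (auto intro: continuous_on_add)

lemma Ck_on_sum:
  assumes "open S" "\<And>i. i \<in> I \<Longrightarrow> Ck_on k S (f i)"
  shows "Ck_on k S (\<lambda>x. \<Sum>i\<in>I. f i x)"
  using assms
  by (induction I rule: infinite_finite_induct) (auto intro!: Ck_on_const Ck_on_add)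

lemma Ck_on_bounded_linear:
  assumes "bounded_linear L"
  shows "open S \<Longrightarrow> Ck_on k S f \<Longrightarrow> Ck_on k S (\<lambda>x. L (f x))"
proof (induction k arbitrary: f)
  case (Suc k)
  show ?case
    by (rule Ck_on_SucI[OF Suc.prems(1)])
      (use Suc in \<open>auto intro!: bounded_linear.has_derivative[OF assms] simp: frechet_derivative_works\<close>)
qed (auto intro: bounded_linear.continuous_on[OF assms])

lemma Ck_on_mult:
  fixes f g :: "'a::euclidean_space \<Rightarrow> real"
  shows "open S \<Longrightarrow> Ck_on k S f \<Longrightarrow> Ck_on k S g \<Longrightarrow> Ck_on k S (\<lambda>x. f x * g x)"
proof (induction k arbitrary: f g)
  case (Suc k)
  have 1: "Ck_on k S f" "Ck_on k S g" using Suc.prems Ck_on_Suc_imp by blast+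
  show ?case
    by (rule Ck_on_SucI[OF Suc.prems(1)
          has_derivative_mult[OF Ck_on_has_derivative[OF Suc.prems(2)] Ck_on_has_derivative[OF Suc.prems(3)]]])
      (use 1 Suc in \<open>auto intro!: Ck_on_add\<close>)
qed (auto intro: continuous_on_mult)

lemma Ck_on_inverse:
  fixes f :: "'a::euclidean_space \<Rightarrow> real"
  assumes "\<And>x. x \<in> S \<Longrightarrow> f x \<noteq> 0"
  shows "open S \<Longrightarrow> Ck_on k S f \<Longrightarrow> Ck_on k S (\<lambda>x. inverse (f x))"
proof (induction k)
  case (Suc k)
  have 1: "Ck_on k S (\<lambda>x. inverse (f x))" using Suc Ck_on_Suc_imp by blast
  have 2: "Ck_on k S (\<lambda>x. - (inverse (f x) * frechet_derivative f (at x) h * inverse (f x)))" for h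
    by (intro Ck_on_bounded_linear[OF bounded_linear_minus[OF bounded_linear_ident]] Ck_on_mult)
      (use 1 Suc in auto)
  show ?case
    by (rule Ck_on_SucI[OF Suc.prems(1) Deriv.has_derivative_inverse[OF assms Ck_on_has_derivative[OF Suc.prems(2)]] 2])
qed (use assms in \<open>auto intro: continuous_on_inverse\<close>)

text \<open>
  No induction is needed: the derivative of \<open>ln f\<close> is \<open>f'\<close> times \<open>1 / f\<close>, whose class is already known.
\<close>
lemma Ck_on_ln:
  fixes f :: "'a::euclidean_space \<Rightarrow> real"
  assumes pos: "\<And>x. x \<in> S \<Longrightarrow> 0 < f x" and "open S" and f: "Ck_on k S f"
  shows "Ck_on k S (\<lambda>x. ln (f x))"
proof (cases k)
  case 0
  have "f x \<noteq> 0" if "x \<in> S" for x using pos[OF that] by simp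
  then show ?thesis using f 0 by (auto intro!: continuous_on_ln)
next
  case (Suc j)
  have "((\<lambda>x. ln (f x)) has_derivative (\<lambda>h. frechet_derivative f (at x) h * inverse (f x))) (at x)"
    if "x \<in> S" for x
    using Ck_on_has_derivative[OF f[unfolded Suc] that] pos[OF that]
    by (auto intro!: derivative_eq_intros simp: divide_inverse mult.commute)
  moreover have "Ck_on j S (\<lambda>x. frechet_derivative f (at x) h * inverse (f x))" for h
    by (intro Ck_on_mult Ck_on_inverse)
      (use assms Suc Ck_on_Suc_imp[OF f[unfolded Suc]] in force)+
  ultimately show ?thesis
    unfolding Suc by (intro Ck_on_SucI[OF \<open>open S\<close>])
qed

lemma Ck_on_slice:
  fixes f :: "'a::euclidean_space \<times> 'b::euclidean_space \<Rightarrow> 'c::real_normed_vector"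
  assumes "open S"
  shows "Ck_on k S f \<Longrightarrow> Ck_on k {x. (x, y) \<in> S} (\<lambda>x. f (x, y))"
proof (induction k arbitrary: f)
  case 0
  have "continuous_on {x. (x, y) \<in> S} (\<lambda>x. f (x, y))"
    by (rule continuous_on_compose2[of S f]) (use 0 in \<open>auto intro!: continuous_intros\<close>)
  then show ?case by simp
next
  case (Suc k)
  have o: "open {x. (x, y) \<in> S}"
    using open_vimage[OF assms continuous_on_Pair[OF continuous_on_id continuous_on_const], of y]
    by (simp add: vimage_def)
  have "((\<lambda>x. f (x, y)) has_derivative (\<lambda>h. frechet_derivative f (at (x, y)) (h, 0))) (at x)"
    if "x \<in> {x. (x, y) \<in> S}" for x
  proof (rule has_derivative_compose[of "\<lambda>x. (x, y)"])
    show "((\<lambda>x. (x, y)) has_derivative (\<lambda>h. (h, 0))) (at x)"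
      by (intro has_derivative_Pair has_derivative_ident has_derivative_const)
    show "(f has_derivative frechet_derivative f (at (x, y))) (at (x, y))"
      using Ck_on_has_derivative[OF Suc.prems] that by simp
  qed
  then show ?case
    by (rule Ck_on_SucI[OF o]) (use Suc in auto)
qed

lemma smooth_on_has_derivative:
  "smooth_on S f \<Longrightarrow> x \<in> S \<Longrightarrow> (f has_derivative frechet_derivative f (at x)) (at x)"
  using Ck_on_has_derivative unfolding smooth_on_def by blast

lemma smooth_on_derivative:
  "smooth_on S f \<Longrightarrow> smooth_on S (\<lambda>x. frechet_derivative f (at x) h)"
  unfolding smooth_on_def using Ck_on.simps(2) by blast

lemma smooth_on_continuous: "smooth_on S f \<Longrightarrow> continuous_on S f"
  unfolding smooth_on_def by (metis Ck_on.simps(1))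

lemma smooth_on_subset: "smooth_on S f \<Longrightarrow> T \<subseteq> S \<Longrightarrow> smooth_on T f"
  unfolding smooth_on_def using Ck_on_subset by blast

lemma smooth_on_cong:
  "smooth_on S f \<Longrightarrow> open S \<Longrightarrow> (\<And>x. x \<in> S \<Longrightarrow> f x = g x) \<Longrightarrow> smooth_on S g"
  unfolding smooth_on_def using Ck_on_cong[of S f g] by blast

lemma smooth_on_local:
  assumes "open S" "\<And>x. x \<in> S \<Longrightarrow> \<exists>T. open T \<and> x \<in> T \<and> smooth_on T f"
  shows "smooth_on S f"
  using assms Ck_on_local[of S _ f] unfolding smooth_on_def by metis

lemma smooth_on_add:
  "open S \<Longrightarrow> smooth_on S f \<Longrightarrow> smooth_on S g \<Longrightarrow> smooth_on S (\<lambda>x. f x + g x)"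
  by (simp add: smooth_on_def Ck_on_add)

lemma smooth_on_sum:
  "open S \<Longrightarrow> (\<And>i. i \<in> I \<Longrightarrow> smooth_on S (f i)) \<Longrightarrow> smooth_on S (\<lambda>x. \<Sum>i\<in>I. f i x)"
  by (simp add: smooth_on_def Ck_on_sum)

lemma smooth_on_bounded_linear:
  "bounded_linear L \<Longrightarrow> open S \<Longrightarrow> smooth_on S f \<Longrightarrow> smooth_on S (\<lambda>x. L (f x))"
  by (simp add: smooth_on_def Ck_on_bounded_linear)

lemma smooth_on_mult:
  fixes f g :: "'a::euclidean_space \<Rightarrow> real"
  shows "open S \<Longrightarrow> smooth_on S f \<Longrightarrow> smooth_on S g \<Longrightarrow> smooth_on S (\<lambda>x. f x * g x)"
  by (simp add: smooth_on_def Ck_on_mult)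

lemma smooth_on_divide:
  fixes f g :: "'a::euclidean_space \<Rightarrow> real"
  shows "open S \<Longrightarrow> smooth_on S f \<Longrightarrow> smooth_on S g \<Longrightarrow> (\<And>x. x \<in> S \<Longrightarrow> g x \<noteq> 0)
    \<Longrightarrow> smooth_on S (\<lambda>x. f x / g x)"
  unfolding divide_inverse by (simp add: smooth_on_def Ck_on_mult Ck_on_inverse)

lemma smooth_on_ln:
  fixes f :: "'a::euclidean_space \<Rightarrow> real"
  shows "(\<And>x. x \<in> S \<Longrightarrow> 0 < f x) \<Longrightarrow> open S \<Longrightarrow> smooth_on S f \<Longrightarrow> smooth_on S (\<lambda>x. ln (f x))"
  by (simp add: smooth_on_def Ck_on_ln)

lemma smooth_on_slice:
  "open S \<Longrightarrow> smooth_on S f \<Longrightarrow> smooth_on {x. (x, y) \<in> S} (\<lambda>x. f (x, y))"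
  by (simp add: smooth_on_def Ck_on_slice)

lemma smooth_on_vec:
  fixes f :: "'n::finite \<Rightarrow> 'a::euclidean_space \<Rightarrow> real"
  assumes "open S" "\<And>i. smooth_on S (f i)"
  shows "smooth_on S (\<lambda>x. \<chi> i. f i x)"
proof -
  have "smooth_on S (\<lambda>x. \<Sum>i\<in>UNIV. f i x *\<^sub>R (axis i 1 :: real^'n))"
    by (intro smooth_on_sum assms smooth_on_bounded_linear[OF bounded_linear_scaleR_left])
  moreover have "(\<Sum>i\<in>UNIV. f i x *\<^sub>R (axis i 1 :: real^'n)) = (\<chi> i. f i x)" for x
    by (simp add: vec_eq_iff axis_def if_distrib cong: if_cong)
  ultimately show ?thesis by simp
qed

section \<open>Symmetry of second derivatives\<close>

text \<open>
  The mean value theorem applied first in direction \<open>h\<close>, to the difference of two translates, and then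
  in direction \<open>k\<close>. The left-hand side is symmetric in \<open>h\<close> and \<open>k\<close>, which is what forces the mixed
  derivatives to agree.
\<close>
lemma second_difference_eq:
  fixes f :: "'a::euclidean_space \<Rightarrow> real"
  assumes f: "smooth_on S f" and "0 < t"
    and S: "\<And>r s. r \<in> {0..t} \<Longrightarrow> s \<in> {0..t} \<Longrightarrow> x + r *\<^sub>R h + s *\<^sub>R k \<in> S"
  shows "\<exists>r\<in>{0..t}. \<exists>s\<in>{0..t}. f (x + t *\<^sub>R h + t *\<^sub>R k) - f (x + t *\<^sub>R h) - f (x + t *\<^sub>R k) + f x
    = t * t * frechet_derivative (\<lambda>z. frechet_derivative f (at z) h) (at (x + r *\<^sub>R h + s *\<^sub>R k)) k"
proof -
  have line: "((\<lambda>u. g (a + u *\<^sub>R v)) has_derivative (\<lambda>u. u * frechet_derivative g (at (a + r *\<^sub>R v)) v)) (at r within T)"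
    if g: "smooth_on S g" and z: "a + r *\<^sub>R v \<in> S" for g :: "'a \<Rightarrow> real" and a v r T
  proof -
    have D: "(g has_derivative frechet_derivative g (at (a + r *\<^sub>R v))) (at (a + r *\<^sub>R v))"
      by (rule smooth_on_has_derivative[OF g z])
    have "((\<lambda>u. a + u *\<^sub>R v) has_derivative (\<lambda>u. u *\<^sub>R v)) (at r within T)"
      by (auto intro!: derivative_eq_intros)
    from has_derivative_compose[OF this D] show ?thesis
      by (simp add: linear_cmul[OF has_derivative_linear[OF D]])
  qed
  have d: "((\<lambda>r. f (x + r *\<^sub>R h + s *\<^sub>R k)) has_derivative (\<lambda>u. u * frechet_derivative f (at (x + r *\<^sub>R h + s *\<^sub>R k)) h)) (at r within T)"
    if "x + r *\<^sub>R h + s *\<^sub>R k \<in> S" for r s T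
    using line[OF f, of "x + s *\<^sub>R k" r h T] that by (simp add: add_ac)
  let ?g = "\<lambda>z. frechet_derivative f (at z) h"
  have g: "smooth_on S ?g" by (rule smooth_on_derivative[OF f])
  have d2: "((\<lambda>s. ?g (x + r *\<^sub>R h + s *\<^sub>R k)) has_derivative (\<lambda>u. u * frechet_derivative ?g (at (x + r *\<^sub>R h + s *\<^sub>R k)) k)) (at s within T)"
    if "x + r *\<^sub>R h + s *\<^sub>R k \<in> S" for r s T
    by (rule line[OF g that])
  have "\<exists>r\<in>{0<..<t}. (f (x + t *\<^sub>R h + t *\<^sub>R k) - f (x + t *\<^sub>R h + 0 *\<^sub>R k)) - (f (x + 0 *\<^sub>R h + t *\<^sub>R k) - f (x + 0 *\<^sub>R h + 0 *\<^sub>R k))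
     = (t - 0) * ?g (x + r *\<^sub>R h + t *\<^sub>R k) - (t - 0) * ?g (x + r *\<^sub>R h + 0 *\<^sub>R k)"
    by (rule mvt_simple[OF \<open>0 < t\<close>, where f="\<lambda>r. f (x + r *\<^sub>R h + t *\<^sub>R k) - f (x + r *\<^sub>R h + 0 *\<^sub>R k)"])
      (rule has_derivative_diff[OF d d]; rule S; use \<open>0 < t\<close> in auto)
  then obtain r where "r \<in> {0<..<t}"
    and eq: "(f (x + t *\<^sub>R h + t *\<^sub>R k) - f (x + t *\<^sub>R h + 0 *\<^sub>R k)) - (f (x + 0 *\<^sub>R h + t *\<^sub>R k) - f (x + 0 *\<^sub>R h + 0 *\<^sub>R k))
     = (t - 0) * ?g (x + r *\<^sub>R h + t *\<^sub>R k) - (t - 0) * ?g (x + r *\<^sub>R h + 0 *\<^sub>R k)"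
    by blast
  then have r: "r \<in> {0..t}" by simp
  have 1: "(f (x + t *\<^sub>R h + t *\<^sub>R k) - f (x + t *\<^sub>R h)) - (f (x + t *\<^sub>R k) - f x)
     = t * (?g (x + r *\<^sub>R h + t *\<^sub>R k) - ?g (x + r *\<^sub>R h))"
    using eq by (simp add: right_diff_distrib)
  have "\<exists>s\<in>{0<..<t}. ?g (x + r *\<^sub>R h + t *\<^sub>R k) - ?g (x + r *\<^sub>R h + 0 *\<^sub>R k)
     = (t - 0) * frechet_derivative ?g (at (x + r *\<^sub>R h + s *\<^sub>R k)) k"
    by (rule mvt_simple[OF \<open>0 < t\<close>, where f="\<lambda>s. ?g (x + r *\<^sub>R h + s *\<^sub>R k)"])
      (rule d2; rule S; use r in auto)
  then obtain s where "s \<in> {0<..<t}"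
    and eq: "?g (x + r *\<^sub>R h + t *\<^sub>R k) - ?g (x + r *\<^sub>R h + 0 *\<^sub>R k)
      = (t - 0) * frechet_derivative ?g (at (x + r *\<^sub>R h + s *\<^sub>R k)) k"
    by blast
  then have s: "s \<in> {0..t}" by simp
  have 2: "?g (x + r *\<^sub>R h + t *\<^sub>R k) - ?g (x + r *\<^sub>R h) = t * frechet_derivative ?g (at (x + r *\<^sub>R h + s *\<^sub>R k)) k"
    using eq by simp
  show ?thesis
    by (rule bexI[OF _ r], rule bexI[OF _ s]) (use 1 2 in \<open>simp add: algebra_simps\<close>)
qed

text \<open>
  For small \<open>t\<close> the same second difference, divided by \<open>t\<^sup>2\<close>, is a value of either mixed derivative
  near \<open>x\<close>; continuity of both leaves no room between them.
\<close>
lemma smooth_on_symmetric_second_derivative: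
  fixes f :: "'a::euclidean_space \<Rightarrow> real"
  assumes "open S" and f: "smooth_on S f" and "x \<in> S"
  shows "frechet_derivative (\<lambda>z. frechet_derivative f (at z) h) (at x) k
       = frechet_derivative (\<lambda>z. frechet_derivative f (at z) k) (at x) h"
proof -
  let ?A = "\<lambda>z. frechet_derivative (\<lambda>z. frechet_derivative f (at z) h) (at z) k"
  let ?B = "\<lambda>z. frechet_derivative (\<lambda>z. frechet_derivative f (at z) k) (at z) h"
  have cont: "isCont ?A x" "isCont ?B x"
    using smooth_on_continuous[OF smooth_on_derivative[OF smooth_on_derivative[OF f]]] assms
    by (auto simp: continuous_on_eq_continuous_at)
  have "dist (?A x) (?B x) \<le> e" if e: "e > 0" for e
  proof -
    obtain d1 where d1: "d1 > 0" "\<And>z. dist z x < d1 \<Longrightarrow> dist (?A z) (?A x) < e / 2"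
      using cont(1) e unfolding continuous_at_eps_delta by (metis half_gt_zero)
    obtain d2 where d2: "d2 > 0" "\<And>z. dist z x < d2 \<Longrightarrow> dist (?B z) (?B x) < e / 2"
      using cont(2) e unfolding continuous_at_eps_delta by (metis half_gt_zero)
    obtain d3 where d3: "d3 > 0" "\<And>z. dist z x < d3 \<Longrightarrow> z \<in> S"
      using \<open>open S\<close> \<open>x \<in> S\<close> unfolding open_dist by blast
    define d where "d = min d1 (min d2 d3)"
    \<comment> \<open>The summand \<open>1\<close> keeps the denominator positive when \<open>h = k = 0\<close>.\<close>
    define t where "t = d / 2 / (norm h + norm k + 1)"
    have n: "norm h + norm k + 1 > 0" by (smt (verit) norm_ge_zero)
    have d: "d > 0" using d1 d2 d3 by (simp add: d_def)
    have t: "t > 0" using d n by (simp add: t_def)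
    have near: "dist (x + r *\<^sub>R h + s *\<^sub>R k) x < d" if "r \<in> {0..t}" "s \<in> {0..t}" for r s
    proof -
      have "dist (x + r *\<^sub>R h + s *\<^sub>R k) x = norm (r *\<^sub>R h + s *\<^sub>R k)" by (simp add: dist_norm)
      also have "\<dots> \<le> r * norm h + s * norm k"
        using that norm_triangle_ineq[of "r *\<^sub>R h" "s *\<^sub>R k"] by simp
      also have "\<dots> \<le> t * norm h + t * norm k"
        using that by (intro add_mono mult_right_mono) auto
      also have "\<dots> \<le> t * (norm h + norm k + 1)" using t by (simp add: algebra_simps)
      also have "\<dots> = d / 2" using n unfolding t_def by (metis less_irrefl nonzero_eq_divide_eq)
      finally show ?thesis using d by simp
    qed
    let ?D = "f (x + t *\<^sub>R h + t *\<^sub>R k) - f (x + t *\<^sub>R h) - f (x + t *\<^sub>R k) + f x"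
    obtain r s where rs: "r \<in> {0..t}" "s \<in> {0..t}" and 1: "?D = t * t * ?A (x + r *\<^sub>R h + s *\<^sub>R k)"
      using second_difference_eq[OF f t, of x h k] near d3 by (auto simp: d_def)
    have "x + s *\<^sub>R k + r *\<^sub>R h \<in> S" if "r \<in> {0..t}" "s \<in> {0..t}" for r s
      using near[OF that] d3 by (auto simp: d_def add_ac)
    then obtain s' r' where rs': "r' \<in> {0..t}" "s' \<in> {0..t}"
      and 2: "f (x + t *\<^sub>R k + t *\<^sub>R h) - f (x + t *\<^sub>R k) - f (x + t *\<^sub>R h) + f x = t * t * ?B (x + s' *\<^sub>R k + r' *\<^sub>R h)"
      using second_difference_eq[OF f t, of x k h] by blast
    have "?D = t * t * ?B (x + r' *\<^sub>R h + s' *\<^sub>R k)"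
      using 2 by (simp add: add_ac)
    with 1 t have "?A (x + r *\<^sub>R h + s *\<^sub>R k) = ?B (x + r' *\<^sub>R h + s' *\<^sub>R k)" by simp
    moreover have "dist (?A (x + r *\<^sub>R h + s *\<^sub>R k)) (?A x) < e / 2"
      by (rule d1(2)) (use near[OF rs] in \<open>simp add: d_def\<close>)
    moreover have "dist (?B (x + r' *\<^sub>R h + s' *\<^sub>R k)) (?B x) < e / 2"
      by (rule d2(2)) (use near[OF rs'] in \<open>simp add: d_def\<close>)
    ultimately show ?thesis unfolding dist_real_def by arith
  qed
  then show ?thesis by (metis dist_le_zero_iff field_le_epsilon add.left_neutral)
qed

section \<open>Partial derivatives on \<open>TM\<close> and Euler's relation\<close>

lemma frechet_derivative_sum_at:
  assumes "\<And>i. i \<in> I \<Longrightarrow> f i differentiable (at z)"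
  shows "frechet_derivative (\<lambda>z. \<Sum>i\<in>I. f i z) (at z) h = (\<Sum>i\<in>I. frechet_derivative (f i) (at z) h)"
proof -
  have "((\<lambda>z. \<Sum>i\<in>I. f i z) has_derivative (\<lambda>h. \<Sum>i\<in>I. frechet_derivative (f i) (at z) h)) (at z)"
    by (intro has_derivative_sum) (use assms frechet_derivative_works in blast)
  then show ?thesis by (rule fun_cong[OF frechet_derivative_at[symmetric]])
qed

lemma frechet_derivative_diff_at:
  assumes "f differentiable (at z)" "g differentiable (at z)"
  shows "frechet_derivative (\<lambda>z. f z - g z) (at z) h
    = frechet_derivative f (at z) h - frechet_derivative g (at z) h"
proof -
  have "((\<lambda>z. f z - g z) has_derivative (\<lambda>h. frechet_derivative f (at z) h - frechet_derivative g (at z) h)) (at z)"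
    by (intro has_derivative_diff) (use assms frechet_derivative_works in blast)+
  then show ?thesis by (rule fun_cong[OF frechet_derivative_at[symmetric]])
qed

lemma frechet_derivative_mult_at:
  fixes f g :: "'a::real_normed_vector \<Rightarrow> real"
  assumes "f differentiable (at z)" "g differentiable (at z)"
  shows "frechet_derivative (\<lambda>z. f z * g z) (at z) h
    = f z * frechet_derivative g (at z) h + frechet_derivative f (at z) h * g z"
proof -
  have "((\<lambda>z. f z * g z) has_derivative (\<lambda>h. f z * frechet_derivative g (at z) h + frechet_derivative f (at z) h * g z)) (at z)"
    by (intro has_derivative_mult) (use assms frechet_derivative_works in blast)+
  then show ?thesis by (rule fun_cong[OF frechet_derivative_at[symmetric]])
qed

lemma linear_axis_expansion:
  fixes L :: "real^'n \<Rightarrow> real"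
  assumes "linear L"
  shows "L v = (\<Sum>i\<in>UNIV. v $ i * L (axis i 1))"
proof -
  have "L v = L (\<Sum>i\<in>UNIV. v $ i *\<^sub>R axis i 1)"
    using basis_expansion[of v] by (simp add: scalar_mult_eq_scaleR)
  then show ?thesis
    by (simp add: linear_sum[OF assms] linear_cmul[OF assms] o_def)
qed

lemma frechet_derivative_vertical:
  assumes "f differentiable (at z)"
  shows "frechet_derivative f (at z) (0, v) = (\<Sum>i\<in>UNIV. v $ i * pdy i f z)"
proof -
  interpret L: linear "frechet_derivative f (at z)" by (rule linear_frechet_derivative[OF assms])
  have "linear (\<lambda>v. frechet_derivative f (at z) (0, v))"
  proof (rule linearI)
    fix a b :: "real^'a" and c :: real
    show "frechet_derivative f (at z) (0, a + b) = frechet_derivative f (at z) (0, a) + frechet_derivative f (at z) (0, b)"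
      using L.add[of "(0, a)" "(0, b)"] by simp
    show "frechet_derivative f (at z) (0, c *\<^sub>R a) = c *\<^sub>R frechet_derivative f (at z) (0, a)"
      using L.scaleR[of c "(0, a)"] by simp
  qed
  from linear_axis_expansion[OF this, of v] show ?thesis by (simp add: pdy_def)
qed

lemma frechet_derivative_horizontal:
  assumes "f differentiable (at z)"
  shows "frechet_derivative f (at z) (v, 0) = (\<Sum>i\<in>UNIV. v $ i * pdx i f z)"
proof -
  interpret L: linear "frechet_derivative f (at z)" by (rule linear_frechet_derivative[OF assms])
  have "linear (\<lambda>v. frechet_derivative f (at z) (v, 0))"
  proof (rule linearI)
    fix a b :: "real^'a" and c :: real
    show "frechet_derivative f (at z) (a + b, 0) = frechet_derivative f (at z) (a, 0) + frechet_derivative f (at z) (b, 0)"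
      using L.add[of "(a, 0)" "(b, 0)"] by simp
    show "frechet_derivative f (at z) (c *\<^sub>R a, 0) = c *\<^sub>R frechet_derivative f (at z) (a, 0)"
      using L.scaleR[of c "(a, 0)"] by simp
  qed
  from linear_axis_expansion[OF this, of v] show ?thesis by (simp add: pdx_def)
qed

lemma has_derivative_vertical:
  assumes "f differentiable (at (x, y))"
  shows "((\<lambda>y. f (x, y)) has_derivative (\<lambda>v. \<Sum>i\<in>UNIV. v $ i * pdy i f (x, y))) (at y)"
proof -
  have "((\<lambda>y. (x, y)) has_derivative (\<lambda>v. (0, v))) (at y)"
    by (intro has_derivative_Pair has_derivative_ident has_derivative_const)
  from has_derivative_compose[OF this] assms show ?thesis
    by (simp add: frechet_derivative_works frechet_derivative_vertical[OF assms, symmetric])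
qed

lemma has_derivative_horizontal:
  assumes "f differentiable (at (x, y))"
  shows "((\<lambda>x. f (x, y)) has_derivative (\<lambda>v. \<Sum>i\<in>UNIV. v $ i * pdx i f (x, y))) (at x)"
proof -
  have "((\<lambda>x. (x, y)) has_derivative (\<lambda>v. (v, 0))) (at x)"
    by (intro has_derivative_Pair has_derivative_ident has_derivative_const)
  from has_derivative_compose[OF this] assms show ?thesis
    by (simp add: frechet_derivative_works frechet_derivative_horizontal[OF assms, symmetric])
qed

text \<open>
  Both sides are the derivative at \<open>t = 1\<close> of \<open>f (x, t y) = t\<^sup>d f (x, y)\<close>.
\<close>
lemma euler_homogeneous:
  assumes hom: "homogeneous_on d U f" and z: "z \<in> U" and diff: "f differentiable (at z)"
  shows "(\<Sum>l\<in>UNIV. snd z $ l * pdy l f z) = real d * f z"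
proof -
  obtain x y where xy: "z = (x, y)" by (cases z)
  have "((\<lambda>t. t *\<^sub>R y) has_derivative (\<lambda>t. t *\<^sub>R y)) (at (1::real))"
    by (auto intro!: derivative_eq_intros)
  moreover have "((\<lambda>y. f (x, y)) has_derivative (\<lambda>v. \<Sum>i\<in>UNIV. v $ i * pdy i f (x, y))) (at ((1::real) *\<^sub>R y))"
    using has_derivative_vertical[of f x y] diff xy by simp
  ultimately have "((\<lambda>t. f (x, t *\<^sub>R y)) has_derivative (\<lambda>t. \<Sum>i\<in>UNIV. (t *\<^sub>R y) $ i * pdy i f (x, y))) (at (1::real))"
    by (rule has_derivative_compose)
  then have "((\<lambda>t. f (x, t *\<^sub>R y)) has_derivative (\<lambda>t. \<Sum>i\<in>UNIV. (t *\<^sub>R y) $ i * pdy i f z)) (at (1::real))"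
    by (simp only: xy)
  then have "((\<lambda>t. t ^ d * f z) has_derivative (\<lambda>t. \<Sum>i\<in>UNIV. (t *\<^sub>R y) $ i * pdy i f z)) (at (1::real))"
    by (rule has_derivative_transform_within_open[OF _ open_greaterThan[of 0]])
      (use hom z xy in \<open>auto simp: homogeneous_on_def\<close>)
  moreover have "((\<lambda>t. t ^ d * f z) has_derivative (\<lambda>t. t * (real d * f z))) (at (1::real))"
    by (auto intro!: derivative_eq_intros)
  ultimately have "(\<lambda>t. \<Sum>i\<in>UNIV. (t *\<^sub>R y) $ i * pdy i f z) = (\<lambda>t. t * (real d * f z))"
    by (rule has_derivative_unique)
  from fun_cong[OF this, of 1] show ?thesis by (simp add: xy)
qed

lemma homogeneous_on_subset: "homogeneous_on d S f \<Longrightarrow> T \<subseteq> S \<Longrightarrow> homogeneous_on d T f"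
  by (auto simp: homogeneous_on_def)

lemma sum_kronecker:
  fixes f :: "'i::finite \<Rightarrow> real"
  shows "(\<Sum>i\<in>UNIV. (if i = k then 1 else 0) * f i) = f k"
    and "(\<Sum>i\<in>UNIV. (if k = i then 1 else 0) * f i) = f k"
  by (simp_all add: if_distribR if_distrib[of "\<lambda>c. c * _"] cong: if_cong)

section \<open>Horizontal derivatives and the Ricci identity\<close>

locale spray_chart =
  fixes U :: "((real^'n::finite) \<times> (real^'n)) set"
    and G :: "'n \<Rightarrow> (real^'n) \<times> (real^'n) \<Rightarrow> real"
  assumes openU: "open U"
    and smoothG: "\<And>i. smooth_on U (G i)"
    and homG: "\<And>i. homogeneous_on 2 U (G i)"
begin

lemma smooth_differentiable: "smooth_on U f \<Longrightarrow> z \<in> U \<Longrightarrow> f differentiable (at z)"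
  using smooth_on_has_derivative unfolding differentiable_def by blast

lemma smooth_pdx: "smooth_on U f \<Longrightarrow> smooth_on U (pdx k f)"
  using smooth_on_derivative[of U f] by (simp add: pdx_def[abs_def])

lemma smooth_pdy: "smooth_on U f \<Longrightarrow> smooth_on U (pdy k f)"
  using smooth_on_derivative[of U f] by (simp add: pdy_def[abs_def])

lemma smooth_coord: "smooth_on U (\<lambda>z. snd z $ l)"
proof -
  have L: "bounded_linear (\<lambda>z :: (real^'n) \<times> (real^'n). snd z $ l)"
    by (intro bounded_linear_compose[OF bounded_linear_vec_nth] bounded_linear_snd)
  have "Ck_on k U (\<lambda>z. snd z $ l)" for k
  proof (cases k)
    case 0
    then show ?thesis by (simp add: linear_continuous_on[OF L])
  next
    case (Suc j)
    show ?thesis unfolding Suc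
      by (rule Ck_on_SucI[OF openU bounded_linear.has_derivative[OF L has_derivative_ident] Ck_on_const[OF openU]])
  qed
  then show ?thesis by (simp add: smooth_on_def)
qed

lemma smooth_mult:
  fixes f g :: "(real^'n) \<times> (real^'n) \<Rightarrow> real"
  shows "smooth_on U f \<Longrightarrow> smooth_on U g \<Longrightarrow> smooth_on U (\<lambda>z. f z * g z)"
  by (rule smooth_on_mult[OF openU])

lemma smooth_sum:
  fixes f :: "'i \<Rightarrow> (real^'n) \<times> (real^'n) \<Rightarrow> real"
  shows "(\<And>i. smooth_on U (f i)) \<Longrightarrow> smooth_on U (\<lambda>z. \<Sum>i\<in>I. f i z)"
  by (rule smooth_on_sum[OF openU])

lemma smooth_diff:
  fixes f g :: "(real^'n) \<times> (real^'n) \<Rightarrow> real"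
  assumes "smooth_on U f" "smooth_on U g"
  shows "smooth_on U (\<lambda>z. f z - g z)"
  using smooth_on_add[OF openU assms(1)
      smooth_on_bounded_linear[OF bounded_linear_minus[OF bounded_linear_ident] openU assms(2)]]
  by simp

lemmas smooth_intros = smoothG smooth_pdx smooth_pdy smooth_coord smooth_mult smooth_sum smooth_diff

lemma pdx_rules:
  assumes "z \<in> U"
  shows pdx_mult: "smooth_on U f \<Longrightarrow> smooth_on U g \<Longrightarrow> pdx k (\<lambda>z. f z * g z) z = f z * pdx k g z + pdx k f z * g z"
    and pdx_diff: "smooth_on U f \<Longrightarrow> smooth_on U g \<Longrightarrow> pdx k (\<lambda>z. f z - g z) z = pdx k f z - pdx k g z"
    and pdx_sum: "(\<And>i. smooth_on U (h i)) \<Longrightarrow> pdx k (\<lambda>z. \<Sum>i\<in>I. h i z) z = (\<Sum>i\<in>I. pdx k (h i) z)"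
  using assms unfolding pdx_def
  by (simp_all add: frechet_derivative_mult_at frechet_derivative_diff_at frechet_derivative_sum_at smooth_differentiable)

lemma pdy_rules:
  assumes "z \<in> U"
  shows pdy_mult: "smooth_on U f \<Longrightarrow> smooth_on U g \<Longrightarrow> pdy k (\<lambda>z. f z * g z) z = f z * pdy k g z + pdy k f z * g z"
    and pdy_diff: "smooth_on U f \<Longrightarrow> smooth_on U g \<Longrightarrow> pdy k (\<lambda>z. f z - g z) z = pdy k f z - pdy k g z"
    and pdy_sum: "(\<And>i. smooth_on U (h i)) \<Longrightarrow> pdy k (\<lambda>z. \<Sum>i\<in>I. h i z) z = (\<Sum>i\<in>I. pdy k (h i) z)"
  using assms unfolding pdy_def
  by (simp_all add: frechet_derivative_mult_at frechet_derivative_diff_at frechet_derivative_sum_at smooth_differentiable)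

lemma pd_cong:
  assumes "z \<in> U" "\<And>z. z \<in> U \<Longrightarrow> f z = g z"
  shows pdy_cong: "pdy k f z = pdy k g z"
    and hderiv_cong: "hderiv G k f z = hderiv G k g z"
  using frechet_derivative_cong_open[OF openU assms] by (simp_all add: pdx_def pdy_def hderiv_def)

lemma pd_commute:
  assumes "z \<in> U" "smooth_on U f"
  shows pdx_pdx: "pdx k (pdx l f) z = pdx l (pdx k f) z"
    and pdy_pdx: "pdy k (pdx l f) z = pdx l (pdy k f) z"
    and pdy_pdy: "pdy k (pdy l f) z = pdy l (pdy k f) z"
  using smooth_on_symmetric_second_derivative[OF openU assms(2,1)]
  by (simp_all add: pdx_def[abs_def] pdy_def[abs_def])

lemma pd_coord:
  fixes z :: "(real^'n) \<times> (real^'n)"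
  shows "pdx k (\<lambda>z. snd z $ l) z = 0" "pdy k (\<lambda>z. snd z $ l) z = (if k = l then 1 else 0)"
proof -
  have L: "bounded_linear (\<lambda>z :: (real^'n) \<times> (real^'n). snd z $ l)"
    by (intro bounded_linear_compose[OF bounded_linear_vec_nth] bounded_linear_snd)
  have "frechet_derivative (\<lambda>z :: (real^'n) \<times> (real^'n). snd z $ l) (at z) = (\<lambda>z. snd z $ l)"
    using frechet_derivative_at[OF bounded_linear.has_derivative[OF L has_derivative_ident], symmetric] .
  then show "pdx k (\<lambda>z. snd z $ l) z = 0" "pdy k (\<lambda>z. snd z $ l) z = (if k = l then 1 else 0)"
    by (auto simp: pdx_def pdy_def axis_def)
qed

lemma hderiv_coord: "hderiv G k (\<lambda>z. snd z $ l) z = - pdy k (G l) z"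
  by (simp add: hderiv_def pd_coord if_distrib cong: if_cong)

lemma hderiv_mult:
  assumes "z \<in> U" "smooth_on U f" "smooth_on U g"
  shows "hderiv G k (\<lambda>z. f z * g z) z = f z * hderiv G k g z + hderiv G k f z * g z"
  unfolding hderiv_def
  by (simp add: pdx_mult[OF assms] pdy_mult[OF assms] algebra_simps sum.distrib sum_distrib_left sum_distrib_right)

lemma hderiv_diff:
  assumes "z \<in> U" "smooth_on U f" "smooth_on U g"
  shows "hderiv G k (\<lambda>z. f z - g z) z = hderiv G k f z - hderiv G k g z"
  unfolding hderiv_def
  by (simp add: pdx_diff[OF assms] pdy_diff[OF assms] algebra_simps sum_subtractf)

lemma hderiv_sum:
  assumes "z \<in> U" "\<And>i. smooth_on U (f i)"
  shows "hderiv G k (\<lambda>z. \<Sum>i\<in>I. f i z) z = (\<Sum>i\<in>I. hderiv G k (f i) z)"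
proof -
  have "(\<Sum>r\<in>UNIV. pdy k (G r) z * (\<Sum>i\<in>I. pdy r (f i) z)) = (\<Sum>i\<in>I. \<Sum>r\<in>UNIV. pdy k (G r) z * pdy r (f i) z)"
    unfolding sum_distrib_left by (rule sum.swap)
  then show ?thesis
    unfolding hderiv_def
    by (simp add: pdx_sum[OF assms] pdy_sum[OF assms] sum_subtractf)
qed

text \<open>
  The commutator of \<open>\<delta>\<^sub>k\<close> and the vertical derivative: only the dependence of \<open>G\<^sup>r\<^sub>k\<close> on \<open>y\<close>
  contributes, since coordinate derivatives commute.
\<close>
lemma hderiv_pdy:
  assumes z: "z \<in> U" and f: "smooth_on U f"
  shows "hderiv G k (pdy l f) z = pdy l (hderiv G k f) z + (\<Sum>r\<in>UNIV. pdy l (pdy k (G r)) z * pdy r f z)"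
proof -
  have "pdy l (hderiv G k f) z = pdy l (\<lambda>z. pdx k f z - (\<Sum>r\<in>UNIV. pdy k (G r) z * pdy r f z)) z"
    by (simp add: hderiv_def[abs_def])
  also have "\<dots> = pdy l (pdx k f) z
      - (\<Sum>r\<in>UNIV. pdy k (G r) z * pdy l (pdy r f) z + pdy l (pdy k (G r)) z * pdy r f z)"
    by (simp add: pdy_diff[OF z] pdy_sum[OF z] pdy_mult[OF z] smooth_intros f)
  finally show ?thesis
    using pdy_pdx[OF z f] pdy_pdy[OF z f, of l]
    by (simp add: hderiv_def sum.distrib)
qed

text \<open>
  Expanding \<open>\<delta>\<^sub>k \<delta>\<^sub>l f\<close>, everything except the derivative of the coefficient \<open>G\<^sup>r\<^sub>l\<close> is symmetric
  in \<open>k\<close> and \<open>l\<close>; the expression \<open>S\<close> in the proof collects the symmetric part.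
\<close>
lemma hderiv_commutator:
  assumes z: "z \<in> U" and f: "smooth_on U f"
  shows "hderiv G k (hderiv G l f) z - hderiv G l (hderiv G k f) z
    = - (\<Sum>r\<in>UNIV. (hderiv G k (pdy l (G r)) z - hderiv G l (pdy k (G r)) z) * pdy r f z)"
proof -
  define S where "S k l = pdx k (pdx l f) z - (\<Sum>s\<in>UNIV. pdy k (G s) z * pdx l (pdy s f) z)
      - (\<Sum>r\<in>UNIV. pdy l (G r) z * pdx k (pdy r f) z)
      + (\<Sum>r\<in>UNIV. \<Sum>s\<in>UNIV. pdy l (G r) z * (pdy k (G s) z * pdy s (pdy r f) z))" for k l
  have H: "hderiv G k (hderiv G l f) z = S k l - (\<Sum>r\<in>UNIV. hderiv G k (pdy l (G r)) z * pdy r f z)" for k l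
  proof -
    have "hderiv G k (hderiv G l f) z = hderiv G k (\<lambda>z. pdx l f z - (\<Sum>r\<in>UNIV. pdy l (G r) z * pdy r f z)) z"
      by (simp add: hderiv_def[of G l, abs_def])
    also have "\<dots> = hderiv G k (pdx l f) z
        - (\<Sum>r\<in>UNIV. pdy l (G r) z * hderiv G k (pdy r f) z + hderiv G k (pdy l (G r)) z * pdy r f z)"
      by (simp add: hderiv_diff[OF z] hderiv_sum[OF z] hderiv_mult[OF z] smooth_intros f)
    finally have 1: "hderiv G k (hderiv G l f) z = hderiv G k (pdx l f) z
        - (\<Sum>r\<in>UNIV. pdy l (G r) z * hderiv G k (pdy r f) z + hderiv G k (pdy l (G r)) z * pdy r f z)" .
    have 2: "(\<Sum>r\<in>UNIV. pdy l (G r) z * hderiv G k (pdy r f) z)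
      = (\<Sum>r\<in>UNIV. pdy l (G r) z * pdx k (pdy r f) z)
        - (\<Sum>r\<in>UNIV. \<Sum>s\<in>UNIV. pdy l (G r) z * (pdy k (G s) z * pdy s (pdy r f) z))"
      unfolding hderiv_def right_diff_distrib sum_subtractf sum_distrib_left ..
    have 3: "hderiv G k (pdx l f) z = pdx k (pdx l f) z - (\<Sum>s\<in>UNIV. pdy k (G s) z * pdx l (pdy s f) z)"
      unfolding hderiv_def by (simp add: pdy_pdx[OF z f])
    show ?thesis
      unfolding S_def 1 sum.distrib 2 3 by simp
  qed
  have "(\<Sum>r\<in>UNIV. \<Sum>s\<in>UNIV. pdy l (G r) z * (pdy k (G s) z * pdy s (pdy r f) z))
      = (\<Sum>r\<in>UNIV. \<Sum>s\<in>UNIV. pdy k (G r) z * (pdy l (G s) z * pdy s (pdy r f) z))"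
    by (subst sum.swap) (simp add: pdy_pdy[OF z f] mult.left_commute)
  then have "S k l = S l k"
    unfolding S_def using pdx_pdx[OF z f, of k l] by simp
  then show ?thesis
    unfolding H by (simp add: left_diff_distrib sum_subtractf)
qed

lemma euler_G: "z \<in> U \<Longrightarrow> (\<Sum>l\<in>UNIV. snd z $ l * pdy l (G i) z) = 2 * G i z"
  using euler_homogeneous[OF homG _ smooth_differentiable[OF smoothG]] by simp

lemma euler_pdy_G:
  assumes z: "z \<in> U"
  shows "(\<Sum>l\<in>UNIV. snd z $ l * pdy k (pdy l (G i)) z) = pdy k (G i) z"
proof -
  \<comment> \<open>\<open>2 G\<^sup>i\<close> is written as a sum of two copies, so that the sum rule applies to it.\<close>
  have "pdy k (\<lambda>z. \<Sum>l\<in>UNIV. snd z $ l * pdy l (G i) z) z = pdy k (\<lambda>z. \<Sum>l\<in>{0,1::nat}. G i z) z"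
    by (rule pdy_cong[OF z]) (simp add: euler_G)
  also have "pdy k (\<lambda>z. \<Sum>l\<in>UNIV. snd z $ l * pdy l (G i) z) z
      = (\<Sum>l\<in>UNIV. snd z $ l * pdy k (pdy l (G i)) z + (if k = l then 1 else 0) * pdy l (G i) z)"
    by (simp add: pdy_sum[OF z] pdy_mult[OF z] pd_coord smooth_intros)
  also have "pdy k (\<lambda>z. \<Sum>l\<in>{0,1::nat}. G i z) z = 2 * pdy k (G i) z"
    by (subst pdy_sum[OF z smoothG]) simp
  finally show ?thesis unfolding sum.distrib sum_kronecker by simp
qed

text \<open>
  The Riemann curvature as the contraction with \<open>y\<close> of the curvature of the horizontal distribution.
  To move \<open>\<delta>\<^sub>k\<close> past \<open>y\<^sup>l\<close>, it is applied as a derivation to Euler's relation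
  \<open>y\<^sup>l G\<^sup>i\<^sub>l = 2 G\<^sup>i\<close>; this uses \<open>\<delta>\<^sub>k y\<^sup>l = - G\<^sup>l\<^sub>k\<close>.
\<close>
lemma riemann_eq:
  assumes z: "z \<in> U"
  shows "riemann G i k z = (\<Sum>l\<in>UNIV. snd z $ l * (hderiv G k (pdy l (G i)) z - hderiv G l (pdy k (G i)) z))"
proof -
  have "hderiv G k (\<lambda>z. \<Sum>l\<in>UNIV. snd z $ l * pdy l (G i) z) z = hderiv G k (\<lambda>z. \<Sum>l\<in>{0,1::nat}. G i z) z"
    by (rule hderiv_cong[OF z]) (simp add: euler_G)
  also have "hderiv G k (\<lambda>z. \<Sum>l\<in>UNIV. snd z $ l * pdy l (G i) z) z
      = (\<Sum>l\<in>UNIV. snd z $ l * hderiv G k (pdy l (G i)) z + (- pdy k (G l) z) * pdy l (G i) z)"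
    by (simp add: hderiv_sum[OF z] hderiv_mult[OF z] hderiv_coord smooth_intros)
  also have "hderiv G k (\<lambda>z. \<Sum>l\<in>{0,1::nat}. G i z) z = 2 * hderiv G k (G i) z"
    by (subst hderiv_sum[OF z smoothG]) simp
  finally have 1: "(\<Sum>l\<in>UNIV. snd z $ l * hderiv G k (pdy l (G i)) z)
      = 2 * pdx k (G i) z - (\<Sum>r\<in>UNIV. pdy r (G i) z * pdy k (G r) z)"
    by (simp add: hderiv_def[of G k "G i"] sum.distrib sum_negf sum_subtractf mult.commute)
  have "(\<Sum>l\<in>UNIV. snd z $ l * hderiv G l (pdy k (G i)) z)
      = (\<Sum>l\<in>UNIV. snd z $ l * pdx l (pdy k (G i)) z)
        - (\<Sum>l\<in>UNIV. \<Sum>r\<in>UNIV. snd z $ l * pdy l (G r) z * pdy r (pdy k (G i)) z)"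
    by (simp add: hderiv_def right_diff_distrib sum_subtractf sum_distrib_left mult.assoc)
  also have "(\<Sum>l\<in>UNIV. \<Sum>r\<in>UNIV. snd z $ l * pdy l (G r) z * pdy r (pdy k (G i)) z)
      = (\<Sum>r\<in>UNIV. 2 * G r z * pdy r (pdy k (G i)) z)"
    by (subst sum.swap) (simp add: sum_distrib_right[symmetric] euler_G[OF z])
  finally have 2: "(\<Sum>l\<in>UNIV. snd z $ l * hderiv G l (pdy k (G i)) z)
      = (\<Sum>l\<in>UNIV. snd z $ l * pdx l (pdy k (G i)) z) - 2 * (\<Sum>r\<in>UNIV. G r z * pdy r (pdy k (G i)) z)"
    by (simp add: sum_distrib_left mult.assoc)
  show ?thesis
    unfolding riemann_def by (simp add: right_diff_distrib sum_subtractf 1 2)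
qed

lemma ricci_identity:
  assumes z: "z \<in> U" and f: "smooth_on U f"
  shows "(\<Sum>l\<in>UNIV. snd z $ l * (hderiv G k (hderiv G l f) z - hderiv G l (hderiv G k f) z))
    = - (\<Sum>r\<in>UNIV. riemann G r k z * pdy r f z)"
  unfolding hderiv_commutator[OF z f] riemann_eq[OF z] sum_distrib_right
  by (subst sum.swap) (simp add: sum_negf sum_distrib_left mult.assoc)

text \<open>
  Contracting once more with \<open>y\<close> kills the curvature, which is antisymmetric before contraction.
\<close>
lemma riemann_radial:
  assumes z: "z \<in> U"
  shows "(\<Sum>k\<in>UNIV. riemann G i k z * snd z $ k) = 0"
proof -
  let ?a = "\<lambda>k l. snd z $ k * snd z $ l * hderiv G k (pdy l (G i)) z"
  have "(\<Sum>k\<in>UNIV. riemann G i k z * snd z $ k) = (\<Sum>k\<in>UNIV. \<Sum>l\<in>UNIV. ?a k l - ?a l k)"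
    unfolding riemann_eq[OF z] sum_distrib_right
    by (intro sum.cong refl) (simp add: algebra_simps)
  also have "\<dots> = 0"
    unfolding sum_subtractf using sum.swap[of ?a UNIV UNIV] by simp
  finally show ?thesis .
qed

end

section \<open>Sprays of scalar curvature\<close>

locale scalar_spray_chart = spray_chart U G
  for U :: "((real^'n::finite) \<times> (real^'n)) set" and G +
  fixes R :: "(real^'n) \<times> (real^'n) \<Rightarrow> real" and \<tau> :: "'n \<Rightarrow> (real^'n) \<times> (real^'n) \<Rightarrow> real"
  assumes smoothR: "smooth_on U R"
    and homR: "homogeneous_on 2 U R"
    and smooth\<tau>: "\<And>k. smooth_on U (\<tau> k)"
    and riemann_scalar: "\<And>z i k. z \<in> U \<Longrightarrow> riemann G i k z = R z * (if i = k then 1 else 0) - \<tau> k z * snd z $ i"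
begin

text \<open>
  The Ricci identity with the left-hand side zero and \<open>R\<^sup>r\<^sub>k = R \<delta>\<^sup>r\<^sub>k - \<tau>\<^sub>k y\<^sup>r\<close> substituted. It is used
  for \<open>f = Q\<close> with \<open>d = 1\<close> and for \<open>f = R\<close> with \<open>d = 2\<close>.
\<close>
lemma curvature_of_commuting:
  assumes z: "z \<in> U" and f: "smooth_on U f" and hom: "homogeneous_on d U f"
    and comm: "\<And>l. hderiv G k (hderiv G l f) z = hderiv G l (hderiv G k f) z"
  shows "R z * pdy k f z = real d * f z * \<tau> k z"
proof -
  have "0 = (\<Sum>r\<in>UNIV. riemann G r k z * pdy r f z)"
    using ricci_identity[OF z f, of k] comm by simp
  also have "\<dots> = R z * pdy k f z - \<tau> k z * (\<Sum>r\<in>UNIV. snd z $ r * pdy r f z)"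
  proof -
    have "(\<Sum>r\<in>UNIV. riemann G r k z * pdy r f z)
        = (\<Sum>r\<in>UNIV. R z * ((if r = k then 1 else 0) * pdy r f z) - \<tau> k z * (snd z $ r * pdy r f z))"
      by (intro sum.cong refl) (simp add: riemann_scalar[OF z] algebra_simps)
    then show ?thesis unfolding sum_subtractf sum_distrib_left[symmetric] sum_kronecker .
  qed
  also have "\<dots> = R z * pdy k f z - \<tau> k z * (real d * f z)"
    using euler_homogeneous[OF hom z smooth_differentiable[OF f z]] by simp
  finally show ?thesis by simp
qed

text \<open>
  Contracting \<open>R\<^sup>i\<^sub>k = R \<delta>\<^sup>i\<^sub>k - \<tau>\<^sub>k y\<^sup>i\<close> with \<open>y\<^sup>k\<close> gives \<open>0 = (R - \<tau>\<^sub>k y\<^sup>k) y\<^sup>i\<close>. At \<open>y = 0\<close>, which is not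
  excluded from \<open>U\<close>, homogeneity makes both sides zero.
\<close>
lemma R_eq_trace:
  assumes z: "z \<in> U"
  shows "R z = (\<Sum>k\<in>UNIV. \<tau> k z * snd z $ k)"
proof (cases "snd z = 0")
  case True
  moreover obtain x y where xy: "z = (x, y)" by (cases z)
  ultimately have y: "y = 0" by simp
  have "\<forall>t>0. R (x, t *\<^sub>R y) = t\<^sup>2 * R (x, y)"
    using homR z xy by (auto simp: homogeneous_on_def)
  from this[rule_format, of 2] have "R z = 0" using xy y by simp
  then show ?thesis by (simp add: True)
next
  case False
  then obtain i where i: "snd z $ i \<noteq> 0" by (auto simp: vec_eq_iff)
  have "0 = (\<Sum>k\<in>UNIV. riemann G i k z * snd z $ k)" using riemann_radial[OF z] by simp
  also have "\<dots> = R z * snd z $ i - snd z $ i * (\<Sum>k\<in>UNIV. \<tau> k z * snd z $ k)"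
  proof -
    have "(\<Sum>k\<in>UNIV. riemann G i k z * snd z $ k)
        = (\<Sum>k\<in>UNIV. R z * ((if i = k then 1 else 0) * snd z $ k) - snd z $ i * (\<tau> k z * snd z $ k))"
      by (intro sum.cong refl) (simp add: riemann_scalar[OF z] algebra_simps)
    then show ?thesis unfolding sum_subtractf sum_distrib_left[symmetric] sum_kronecker .
  qed
  finally show ?thesis using i by (simp add: algebra_simps)
qed

end

locale constant_spray_chart = scalar_spray_chart U G R \<tau>
  for U :: "((real^'n::finite) \<times> (real^'n)) set" and G R \<tau> +
  assumes parallel: "\<And>z i k. z \<in> U \<Longrightarrow> hderiv_cov G \<tau> i k z = 0"
begin

text \<open>
  Parallelism of \<open>\<tau>\<close> and \<open>\<delta>\<^sub>k y\<^sup>i = - G\<^sup>i\<^sub>k\<close> make the two terms of \<open>\<delta>\<^sub>k (\<tau>\<^sub>i y\<^sup>i)\<close> cancel.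
\<close>
lemma hderiv_R:
  assumes z: "z \<in> U"
  shows "hderiv G k R z = 0"
proof -
  have "hderiv G k R z = hderiv G k (\<lambda>z. \<Sum>i\<in>UNIV. \<tau> i z * snd z $ i) z"
    by (rule hderiv_cong[OF z R_eq_trace])
  also have "\<dots> = (\<Sum>i\<in>UNIV. \<tau> i z * (- pdy k (G i) z) + hderiv G k (\<tau> i) z * snd z $ i)"
    by (simp add: hderiv_sum[OF z] hderiv_mult[OF z] hderiv_coord smooth_intros smooth\<tau>)
  also have "(\<lambda>i. hderiv G k (\<tau> i) z) = (\<lambda>i. \<Sum>r\<in>UNIV. \<tau> r z * pdy k (pdy i (G r)) z)"
    using parallel[OF z] by (simp add: hderiv_cov_def fun_eq_iff)
  then have "(\<Sum>i\<in>UNIV. hderiv G k (\<tau> i) z * snd z $ i)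
      = (\<Sum>i\<in>UNIV. \<Sum>r\<in>UNIV. \<tau> r z * (snd z $ i * pdy k (pdy i (G r)) z))"
    by (simp add: fun_eq_iff sum_distrib_left sum_distrib_right mult_ac)
  then have "(\<Sum>i\<in>UNIV. hderiv G k (\<tau> i) z * snd z $ i) = (\<Sum>r\<in>UNIV. \<tau> r z * pdy k (G r) z)"
    by (subst (asm) sum.swap) (simp add: sum_distrib_left[symmetric] euler_pdy_G[OF z])
  then have "(\<Sum>i\<in>UNIV. \<tau> i z * (- pdy k (G i) z) + hderiv G k (\<tau> i) z * snd z $ i) = 0"
    by (simp add: sum.distrib sum_negf sum_subtractf)
  finally show ?thesis .
qed

text \<open>
  Constant curvature is isotropic where \<open>R \<noteq> 0\<close>: all horizontal derivatives of \<open>R\<close> vanish, in particular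
  they commute.
\<close>
lemma pdy_R:
  assumes z: "z \<in> U" and "R z \<noteq> 0"
  shows "pdy k R z = 2 * \<tau> k z"
proof -
  have "hderiv G i (hderiv G j R) z = 0" for i j
  proof -
    have "hderiv G i (hderiv G j R) z = hderiv G i (\<lambda>_. 0) z"
      by (rule hderiv_cong[OF z hderiv_R])
    also have "\<dots> = 0" by (simp add: hderiv_def pdx_def pdy_def)
    finally show ?thesis .
  qed
  then show ?thesis
    using curvature_of_commuting[OF z smoothR homR, of k] assms by simp
qed

end

section \<open>Funk functions in a chart\<close>

locale funk_chart = scalar_spray_chart U G R \<tau>
  for U :: "((real^'n::finite) \<times> (real^'n)) set" and G R \<tau> +
  fixes Q :: "(real^'n) \<times> (real^'n) \<Rightarrow> real"
  assumes smoothQ: "smooth_on U Q"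
    and homQ: "homogeneous_on 1 U Q"
    and funk: "\<And>z k. z \<in> U \<Longrightarrow> hderiv G k Q z = Q z * pdy k Q z"
begin

text \<open>
  Substituting the Funk equation in the commutator formula,
  \<open>\<delta>\<^sub>k Q\<^sub>.\<^sub>l = Q Q\<^sub>.\<^sub>k\<^sub>.\<^sub>l + Q\<^sub>.\<^sub>k Q\<^sub>.\<^sub>l + G\<^sup>r\<^sub>k\<^sub>l Q\<^sub>.\<^sub>r\<close>, visibly symmetric.
\<close>
lemma hderiv_pdy_Q_sym:
  assumes z: "z \<in> U"
  shows "hderiv G k (pdy l Q) z = hderiv G l (pdy k Q) z"
proof -
  have "hderiv G k (pdy l Q) z = Q z * pdy l (pdy k Q) z + pdy l Q z * pdy k Q z
      + (\<Sum>r\<in>UNIV. pdy l (pdy k (G r)) z * pdy r Q z)" for k l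
    using hderiv_pdy[OF z smoothQ, of k l] pdy_cong[OF z funk[of _ k], where k=l]
      pdy_mult[OF z smoothQ smooth_pdy[OF smoothQ], of l k] by simp
  from this[of k l] this[of l k] show ?thesis
    using pdy_pdy[OF z smoothQ, of k l] pdy_pdy[OF z smoothG, of k l] by simp
qed

lemma R_pdy_Q:
  assumes z: "z \<in> U"
  shows "R z * pdy k Q z = Q z * \<tau> k z"
proof -
  have "hderiv G k (hderiv G l Q) z = Q z * hderiv G k (pdy l Q) z + Q z * pdy k Q z * pdy l Q z" for k l
    using hderiv_cong[OF z funk[of _ l], where k=k] hderiv_mult[OF z smoothQ smooth_pdy[OF smoothQ], of k l]
      funk[OF z, of k] by simp
  then have "hderiv G k (hderiv G l Q) z = hderiv G l (hderiv G k Q) z" for l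
    using hderiv_pdy_Q_sym[OF z, of k l] by simp
  from curvature_of_commuting[OF z smoothQ homQ this] show ?thesis by simp
qed

end

locale isotropic_funk_chart = funk_chart U G R \<tau> Q
  for U :: "((real^'n::finite) \<times> (real^'n)) set" and G R \<tau> Q +
  assumes R_nz: "\<And>z. z \<in> U \<Longrightarrow> R z \<noteq> 0"
    and connected_fibre: "\<And>x. connected {y. (x, y) \<in> U}"
    and isotropic: "\<And>z i. z \<in> U \<Longrightarrow> pdy i R z = 2 * \<tau> i z"
begin

definition sq_ratio where "sq_ratio z = (Q z * Q z) / R z"

lemma sq_ratio_mult_R: "z \<in> U \<Longrightarrow> sq_ratio z * R z = Q z * Q z"
  using R_nz by (simp add: sq_ratio_def)

lemma smooth_sq_ratio: "smooth_on U sq_ratio"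
  unfolding sq_ratio_def[abs_def] by (intro smooth_on_divide[OF openU] smooth_mult smoothQ smoothR R_nz)

text \<open>
  The vertical derivative of \<open>Q\<^sup>2 / R\<close> is proportional to \<open>2 R Q\<^sub>.\<^sub>k - Q R\<^sub>.\<^sub>k = 2 (R Q\<^sub>.\<^sub>k - Q \<tau>\<^sub>k)\<close>. Working
  with the product \<open>(Q\<^sup>2 / R) R = Q\<^sup>2\<close> avoids a quotient rule.
\<close>
lemma pdy_sq_ratio:
  assumes z: "z \<in> U"
  shows "pdy k sq_ratio z = 0"
proof -
  have "sq_ratio z * pdy k R z + pdy k sq_ratio z * R z = Q z * pdy k Q z + pdy k Q z * Q z"
    using pdy_cong[OF z sq_ratio_mult_R, where k=k] pdy_mult[OF z smooth_sq_ratio smoothR, of k]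
      pdy_mult[OF z smoothQ smoothQ, of k] by simp
  then have "R z * (sq_ratio z * (2 * \<tau> k z) + pdy k sq_ratio z * R z) = 2 * Q z * (R z * pdy k Q z)"
    by (simp add: isotropic[OF z] algebra_simps)
  also have "\<dots> = 2 * \<tau> k z * (sq_ratio z * R z)" using R_pdy_Q[OF z, of k] sq_ratio_mult_R[OF z] by simp
  finally show ?thesis using R_nz[OF z] by (simp add: algebra_simps)
qed

end

section \<open>Fibrewise constant functions\<close>

context isotropic_funk_chart
begin

lemma open_fibre: "open {y. (x, y) \<in> U}"
  using open_vimage[OF openU continuous_on_Pair[OF continuous_on_const continuous_on_id], of x]
  by (simp add: vimage_def)

lemma open_slice: "open {x. (x, y) \<in> U}"
  using open_vimage[OF openU continuous_on_Pair[OF continuous_on_id continuous_on_const], of y]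
  by (simp add: vimage_def)

lemma open_base: "open (fst ` U)"
  by (rule open_image_fst[OF openU])

lemma sq_ratio_fibre_constant:
  assumes "(x, y) \<in> U" "(x, y') \<in> U"
  shows "sq_ratio (x, y) = sq_ratio (x, y')"
proof (rule has_derivative_zero_unique_connected[of "{y. (x, y) \<in> U}" "\<lambda>y. sq_ratio (x, y)"])
  fix y assume "y \<in> {y. (x, y) \<in> U}"
  then show "((\<lambda>y. sq_ratio (x, y)) has_derivative (\<lambda>x. 0)) (at y)"
    using has_derivative_vertical[OF smooth_differentiable[OF smooth_sq_ratio], of x y] by (simp add: pdy_sq_ratio)
qed (use assms open_fibre connected_fibre in auto)

text \<open>
  The function \<open>c(x)\<close> in this chart. The choice of \<open>y\<close> is immaterial by \<open>sq_ratio_fibre_constant\<close>, so \<open>c\<close>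
  may be studied through any slice \<open>y = const\<close>.
\<close>
definition base_ratio where "base_ratio x = sq_ratio (x, SOME y. (x, y) \<in> U)"

lemma sq_ratio_eq_base_ratio: "(x, y) \<in> U \<Longrightarrow> sq_ratio (x, y) = base_ratio x"
  unfolding base_ratio_def by (rule sq_ratio_fibre_constant) (auto intro: someI)

text \<open>
  A function of \<open>x\<close> that lifts to a smooth function is smooth, as near any point it is a restriction of
  the lift to a slice \<open>y = const\<close>.
\<close>
lemma smooth_from_slices:
  assumes g: "smooth_on U g" and h: "\<And>x y. (x, y) \<in> U \<Longrightarrow> h x = g (x, y)"
  shows "smooth_on (fst ` U) h"
proof (rule smooth_on_local[OF open_base])
  fix x assume "x \<in> fst ` U"
  then obtain y where "(x, y) \<in> U" by auto
  moreover have "smooth_on {x. (x, y) \<in> U} h"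
    by (rule smooth_on_cong[OF smooth_on_slice[OF openU g] open_slice]) (simp add: h)
  ultimately show "\<exists>T. open T \<and> x \<in> T \<and> smooth_on T h"
    using open_slice by blast
qed

lemma smooth_base_ratio: "smooth_on (fst ` U) base_ratio"
  by (rule smooth_from_slices[OF smooth_sq_ratio]) (simp add: sq_ratio_eq_base_ratio)

lemma pdy_fibre_constant:
  assumes z: "(x, y) \<in> U" and f: "smooth_on U f" and const: "\<And>y'. (x, y') \<in> U \<Longrightarrow> f (x, y') = a"
  shows "pdy k f (x, y) = 0"
proof -
  have "((\<lambda>y. a) has_derivative (\<lambda>v. \<Sum>i\<in>UNIV. v $ i * pdy i f (x, y))) (at y)"
    by (rule has_derivative_transform_within_open[OF
          has_derivative_vertical[OF smooth_differentiable[OF f z]] open_fibre])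
      (use z const in auto)
  from has_derivative_unique[OF this has_derivative_const]
  have "(\<Sum>i\<in>UNIV. axis k 1 $ i * pdy i f (x, y)) = 0" by meson
  then show ?thesis by (simp add: axis_def sum_kronecker)
qed

lemma slice_derivative:
  assumes z: "(x, y) \<in> U" and f: "smooth_on U f" and h: "\<And>x'. (x', y) \<in> U \<Longrightarrow> h x' = f (x', y)"
  shows "(h has_derivative (\<lambda>v. \<Sum>i\<in>UNIV. v $ i * pdx i f (x, y))) (at x)"
  by (rule has_derivative_transform_within_open[OF
        has_derivative_horizontal[OF smooth_differentiable[OF f z]] open_slice[of y]])
    (use z h in auto)

end

section \<open>Constant curvature in a chart\<close>

text \<open>
  The integrating factor \<open>exp (- \<integral> a)\<close> turns \<open>u\<close> into a constant function.
\<close>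
lemma linear_ode_zero:
  fixes u a :: "real \<Rightarrow> real"
  assumes a: "continuous_on {0..1} a"
    and u: "\<And>t. t \<in> {0..1} \<Longrightarrow> (u has_real_derivative a t * u t) (at t within {0..1})"
    and "u 0 = 0"
  shows "u 1 = 0"
proof -
  define E where "E t = exp (- integral {0..t} a)" for t
  have "(E has_real_derivative E t * - a t) (at t within {0..1})" if "t \<in> {0..1}" for t
    unfolding E_def
    by (rule derivative_eq_intros integral_has_real_derivative[OF a that] refl)+
  then have "((\<lambda>t. u t * E t) has_real_derivative 0) (at t within {0..1})" if "t \<in> {0..1}" for t
    using DERIV_mult[OF u[OF that], of E "E t * - a t"] that by (simp add: algebra_simps)
  then obtain k where "\<And>t. t \<in> {0..1} \<Longrightarrow> u t * E t = k"
    using has_field_derivative_zero_constant[of "{0..1}" "\<lambda>t. u t * E t"] by auto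
  from this[of 0] this[of 1] show ?thesis using \<open>u 0 = 0\<close> by (simp add: E_def)
qed

locale constant_funk_chart = constant_spray_chart U G R \<tau> + funk_chart U G R \<tau> Q
  for U :: "((real^'n::finite) \<times> (real^'n)) set" and G R \<tau> Q +
  assumes R_nonzero: "\<And>z. z \<in> U \<Longrightarrow> R z \<noteq> 0"
    and connected_fibres: "\<And>x. connected {y. (x, y) \<in> U}"

sublocale constant_funk_chart \<subseteq> isotropic_funk_chart
  by unfold_locales (use R_nonzero connected_fibres pdy_R in auto)

context constant_funk_chart
begin

text \<open>
  Since \<open>\<delta>\<^sub>k R = 0\<close>, the derivation \<open>\<delta>\<^sub>k\<close> maps \<open>Q\<^sup>2 = (Q\<^sup>2 / R) R\<close> to \<open>2 Q\<^sup>2 Q\<^sub>.\<^sub>k = (Q\<^sup>2 / R)\<^sub>;\<^sub>k R\<close>; and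
  \<open>\<delta>\<^sub>k\<close> reduces to \<open>\<partial>\<^sub>k\<close> on a function without vertical derivative.
\<close>
lemma pdx_sq_ratio:
  assumes z: "z \<in> U"
  shows "pdx k sq_ratio z = 2 * sq_ratio z * pdy k Q z"
proof -
  have "sq_ratio z * hderiv G k R z + hderiv G k sq_ratio z * R z = Q z * hderiv G k Q z + hderiv G k Q z * Q z"
    using hderiv_cong[OF z sq_ratio_mult_R, where k=k] hderiv_mult[OF z smooth_sq_ratio smoothR, of k]
      hderiv_mult[OF z smoothQ smoothQ, of k] by simp
  then have "hderiv G k sq_ratio z * R z = 2 * pdy k Q z * (sq_ratio z * R z)"
    by (simp add: hderiv_R[OF z] funk[OF z] sq_ratio_mult_R[OF z])
  then have "hderiv G k sq_ratio z = 2 * sq_ratio z * pdy k Q z" using R_nz[OF z] by simp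
  then show ?thesis by (simp add: hderiv_def pdy_sq_ratio[OF z])
qed

text \<open>
  By \<open>pdx_sq_ratio\<close>, \<open>2 c Q\<^sub>.\<^sub>k\<close> is the \<open>k\<close>-th partial derivative of \<open>c\<close>, a function of \<open>x\<close>. This settles the
  matter unless \<open>c x = 0\<close>, and then \<open>Q\<^sup>2 = c R\<close> vanishes on the whole fibre over \<open>x\<close>.
\<close>
lemma pdy_Q_fibre_constant:
  assumes z: "(x, y) \<in> U" "(x, y') \<in> U"
  shows "pdy k Q (x, y) = pdy k Q (x, y')"
proof (cases "base_ratio x = 0")
  case True
  have "Q (x, y) = 0" if "(x, y) \<in> U" for y
    using sq_ratio_mult_R[OF that] sq_ratio_eq_base_ratio[OF that] True by simp
  then show ?thesis using pdy_fibre_constant[OF _ smoothQ, of x _ 0] z by simp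
next
  case False
  have D: "(base_ratio has_derivative (\<lambda>v. \<Sum>i\<in>UNIV. v $ i * pdx i sq_ratio (x, y))) (at x)" if "(x, y) \<in> U" for y
    by (rule slice_derivative[OF that smooth_sq_ratio]) (simp add: sq_ratio_eq_base_ratio)
  have "(\<Sum>i\<in>UNIV. axis k 1 $ i * pdx i sq_ratio (x, y)) = (\<Sum>i\<in>UNIV. axis k 1 $ i * pdx i sq_ratio (x, y'))"
    using has_derivative_unique[OF D[OF z(1)] D[OF z(2)]] by meson
  then have "pdx k sq_ratio (x, y) = pdx k sq_ratio (x, y')" by (simp add: axis_def sum_kronecker)
  then show ?thesis using False by (simp add: pdx_sq_ratio z sq_ratio_eq_base_ratio)
qed

text \<open>
  The coefficients \<open>b\<^sub>k(x)\<close> of the 1-form that \<open>Q\<close> turns out to be (\<open>Q_eq_form\<close>).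
\<close>
definition form_coeff :: "real^'n \<Rightarrow> real^'n" where
  "form_coeff x = (\<chi> k. pdy k Q (x, SOME y. (x, y) \<in> U))"

lemma pdy_Q_eq_form_coeff: "(x, y) \<in> U \<Longrightarrow> pdy k Q (x, y) = form_coeff x $ k"
  unfolding form_coeff_def by (simp, rule pdy_Q_fibre_constant) (auto intro: someI)

lemma smooth_form_coeff: "smooth_on (fst ` U) form_coeff"
proof (rule smooth_from_slices[where g="\<lambda>z. \<chi> k. pdy k Q z"])
  show "smooth_on U (\<lambda>z. \<chi> k. pdy k Q z)"
    by (intro smooth_on_vec openU smooth_pdy smoothQ)
qed (simp add: vec_eq_iff pdy_Q_eq_form_coeff)

lemma Q_eq_form: "(x, y) \<in> U \<Longrightarrow> Q (x, y) = (\<Sum>i\<in>UNIV. form_coeff x $ i * y $ i)"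
  using euler_homogeneous[OF homQ _ smooth_differentiable[OF smoothQ], of "(x, y)"]
  by (simp add: pdy_Q_eq_form_coeff mult.commute)

text \<open>
  On a function that does not depend on \<open>y\<close>, such as \<open>Q\<^sub>.\<^sub>i\<close>, \<open>\<delta>\<^sub>j\<close> is \<open>\<partial>\<^sub>j\<close>, so that closedness is the
  symmetry of \<open>\<delta>\<^sub>j Q\<^sub>.\<^sub>i\<close>.
\<close>
lemma form_coeff_closed:
  assumes "x \<in> fst ` U"
  shows "frechet_derivative form_coeff (at x) (axis j 1) $ i = frechet_derivative form_coeff (at x) (axis i 1) $ j"
proof -
  obtain y where z: "(x, y) \<in> U" using assms by auto
  have D: "frechet_derivative form_coeff (at x) (axis j 1) $ i = pdx j (pdy i Q) (x, y)" for i j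
  proof -
    have D1: "((\<lambda>x. form_coeff x $ i) has_derivative (\<lambda>h. frechet_derivative form_coeff (at x) h $ i)) (at x)"
      by (rule bounded_linear.has_derivative[OF bounded_linear_vec_nth smooth_on_has_derivative[OF smooth_form_coeff assms]])
    have D2: "((\<lambda>x. form_coeff x $ i) has_derivative (\<lambda>v. \<Sum>k\<in>UNIV. v $ k * pdx k (pdy i Q) (x, y))) (at x)"
      by (rule slice_derivative[OF z smooth_pdy[OF smoothQ]]) (simp add: pdy_Q_eq_form_coeff)
    from fun_cong[OF has_derivative_unique[OF D1 D2], of "axis j 1"] show ?thesis
      by (simp add: axis_def sum_kronecker)
  qed
  have "pdx j (pdy i Q) (x, y) = hderiv G j (pdy i Q) (x, y)" for i j
    using pdy_fibre_constant[OF z smooth_pdy[OF smoothQ], of i] pdy_Q_eq_form_coeff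
    by (simp add: hderiv_def)
  then show ?thesis
    unfolding D using hderiv_pdy_Q_sym[OF z] by simp
qed

lemma base_ratio_derivative:
  assumes "x \<in> fst ` U"
  shows "(base_ratio has_derivative (\<lambda>v. 2 * base_ratio x * (form_coeff x \<bullet> v))) (at x)"
proof -
  obtain y where z: "(x, y) \<in> U" using assms by auto
  have "(base_ratio has_derivative (\<lambda>v. \<Sum>i\<in>UNIV. v $ i * pdx i sq_ratio (x, y))) (at x)"
    by (rule slice_derivative[OF z smooth_sq_ratio]) (simp add: sq_ratio_eq_base_ratio)
  then show ?thesis
    by (simp add: pdx_sq_ratio[OF z] pdy_Q_eq_form_coeff[OF z] sq_ratio_eq_base_ratio[OF z] inner_vec_def sum_distrib_left mult_ac)
qed

text \<open>
  Restricted to the segment from \<open>x\<close> to \<open>x'\<close>, the equation \<open>dc = 2 c b\<close> is a linear ordinary differential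
  equation with initial value zero.
\<close>
lemma base_ratio_zero_nearby:
  assumes ball: "ball x e \<subseteq> fst ` U" and "base_ratio x = 0" and x': "x' \<in> ball x e"
  shows "base_ratio x' = 0"
proof -
  define \<gamma> where "\<gamma> t = x + t *\<^sub>R (x' - x)" for t :: real
  have \<gamma>: "\<gamma> t \<in> fst ` U" if "t \<in> {0..1}" for t
  proof -
    have "norm (t *\<^sub>R (x' - x)) \<le> 1 * norm (x' - x)"
      unfolding norm_scaleR using that by (intro mult_right_mono) auto
    then have "\<gamma> t \<in> ball x e"
      using x' by (simp add: \<gamma>_def dist_norm norm_minus_commute)
    then show ?thesis using ball by blast
  qed
  have "base_ratio (\<gamma> 1) = 0"
  proof (rule linear_ode_zero[where u="\<lambda>t. base_ratio (\<gamma> t)" and a="\<lambda>t. 2 * (form_coeff (\<gamma> t) \<bullet> (x' - x))"])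
    have "continuous_on {0..1} (\<lambda>t. form_coeff (\<gamma> t))"
      by (rule continuous_on_compose2[OF smooth_on_continuous[OF smooth_form_coeff]])
        (use \<gamma> in \<open>auto simp: \<gamma>_def[abs_def] intro!: continuous_intros\<close>)
    then show "continuous_on {0..1} (\<lambda>t. 2 * (form_coeff (\<gamma> t) \<bullet> (x' - x)))"
      by (intro continuous_intros)
    show "base_ratio (\<gamma> 0) = 0" using \<open>base_ratio x = 0\<close> by (simp add: \<gamma>_def)
    fix t :: real assume t: "t \<in> {0..1}"
    have "(\<gamma> has_derivative (\<lambda>s. s *\<^sub>R (x' - x))) (at t within {0..1})"
      unfolding \<gamma>_def[abs_def] by (auto intro!: derivative_eq_intros)
    from has_derivative_compose[OF this base_ratio_derivative[OF \<gamma>[OF t]]]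
    show "((\<lambda>t. base_ratio (\<gamma> t)) has_real_derivative 2 * (form_coeff (\<gamma> t) \<bullet> (x' - x)) * base_ratio (\<gamma> t)) (at t within {0..1})"
      by (rule has_derivative_imp_has_field_derivative) (simp add: mult_ac)
  qed
  then show ?thesis by (simp add: \<gamma>_def)
qed

text \<open>
  All three level sets of the sign are open: the zero set by \<open>base_ratio_zero_nearby\<close>, the others by
  continuity. On a connected base the sign is therefore constant.
\<close>
lemma open_sgn_base_ratio: "open {x \<in> fst ` U. sgn (base_ratio x) = s}"
proof -
  have cont: "continuous_on (fst ` U) base_ratio" by (rule smooth_on_continuous[OF smooth_base_ratio])
  have pre: "open {x \<in> fst ` U. base_ratio x \<in> T}" if "open T" for T
    using continuous_open_preimage[OF cont open_base that] by (simp add: vimage_def Int_def)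
  have "open {x \<in> fst ` U. base_ratio x = 0}"
    unfolding open_contains_ball
  proof
    fix x assume x: "x \<in> {x \<in> fst ` U. base_ratio x = 0}"
    then obtain e where "e > 0" "ball x e \<subseteq> fst ` U" using open_base by (auto simp: open_contains_ball)
    with x show "\<exists>e>0. ball x e \<subseteq> {x \<in> fst ` U. base_ratio x = 0}" using base_ratio_zero_nearby by blast
  qed
  moreover have "{x \<in> fst ` U. sgn (base_ratio x) = s} =
      (if s = 0 then {x \<in> fst ` U. base_ratio x = 0} else if s = 1 then {x \<in> fst ` U. base_ratio x \<in> {0<..}}
       else if s = -1 then {x \<in> fst ` U. base_ratio x \<in> {..<0}} else {})"
    by (auto simp: sgn_if)
  ultimately show ?thesis using pre[of "{0<..}"] pre[of "{..<0}"] by simp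
qed

end

section \<open>From charts to the manifold\<close>

lemma chart_inv_chart:
  assumes "smooth_atlas A" "\<phi> \<in> A" "p \<in> fst \<phi>"
  shows "chart_inv \<phi> (snd \<phi> p) = p"
proof -
  have "homeomorphism (fst \<phi>) (snd \<phi> ` fst \<phi>) (snd \<phi>) (chart_inv \<phi>)"
    using assms(1,2) by (simp add: smooth_atlas_def)
  from homeomorphism_apply1[OF this assms(3)] show ?thesis .
qed

text \<open>
  Coordinates determine a tangent vector because its components in all other charts are obtained from
  those in \<open>\<phi>\<close> by the Jacobians of the transition maps.
\<close>
lemma coords_inv_coords:
  assumes at: "smooth_atlas A" and \<phi>: "\<phi> \<in> A" and w: "w \<in> tangent_bundle A" "fst w \<in> fst \<phi>"
  shows "coords_inv A \<phi> (coords \<phi> w) = w"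
  unfolding coords_inv_def
proof (rule inv_into_f_f)
  show "inj_on (coords \<phi>) {w \<in> tangent_bundle A. fst w \<in> fst \<phi>}"
  proof (rule inj_onI, clarsimp)
    fix p v p' v'
    assume T: "(p, v) \<in> tangent_bundle A" "(p', v') \<in> tangent_bundle A"
      and p: "p \<in> fst \<phi>" "p' \<in> fst \<phi>" and eq: "coords \<phi> (p, v) = coords \<phi> (p', v')"
    have pp: "p = p'" using chart_inv_chart[OF at \<phi>] p eq by (metis coords_def case_prod_conv fst_conv)
    have vv: "v \<phi> = v' \<phi>" using eq by (simp add: coords_def)
    have tr: "u \<psi> = (if \<psi> \<in> A \<and> p \<in> fst \<psi>
        then frechet_derivative (transition \<phi> \<psi>) (at (snd \<phi> p)) (u \<phi>) else 0)"
      if u: "(p, u) \<in> tangent_bundle A" for u \<psi>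
    proof (cases "\<psi> \<in> A \<and> p \<in> fst \<psi>")
      case True
      then have "u \<psi> = frechet_derivative (transition \<phi> \<psi>) (at (snd \<phi> p)) (u \<phi>)"
        using u p(1) \<phi> unfolding tangent_bundle_def mem_Collect_eq prod.case by blast
      then show ?thesis by (subst if_P[OF True])
    next
      case False
      then have "u \<psi> = 0"
        using u unfolding tangent_bundle_def mem_Collect_eq prod.case by blast
      then show ?thesis by (subst if_not_P[OF False])
    qed
    have "v = v'"
    proof
      fix \<psi>
      show "v \<psi> = v' \<psi>"
        using tr[OF T(1), of \<psi>] tr[OF T(2)[folded pp], of \<psi>] unfolding vv by (rule trans[OF _ sym])
    qed
    then show "p = p' \<and> v = v'" using pp by auto
  qed
qed (use w in auto)

lemma local_expr_coords:
  assumes "smooth_atlas A" "\<phi> \<in> A" "w \<in> tangent_bundle A" "fst w \<in> fst \<phi>"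
  shows "local_expr A \<phi> f (coords \<phi> w) = f w"
  using coords_inv_coords[OF assms] by (simp add: local_expr_def)

lemma coords_in_coord_image:
  "w \<in> D \<Longrightarrow> fst w \<in> fst \<phi> \<Longrightarrow> coords \<phi> w \<in> coord_image \<phi> D"
  by (auto simp: coord_image_def)

lemma fst_coord_image: "fst ` coord_image \<phi> D = snd \<phi> ` (fst \<phi> \<inter> fst ` D)"
  by (force simp: coord_image_def coords_def image_iff)

text \<open>
  Smoothness of a spray is stated for the vector field \<open>(y, - 2 G)\<close>; the coefficients are recovered as
  \<open>- 1/2\<close> times components of its second part.
\<close>
lemma spray_chart_coord_image:
  fixes A :: "('m, 'n::finite) chart set"
  assumes "spray A C G" "\<phi> \<in> A" "conical_region A D" "D \<subseteq> C"
  shows "spray_chart (coord_image \<phi> D) (G \<phi>)"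
proof
  have sub: "coord_image \<phi> D \<subseteq> coord_image \<phi> C" using assms by (auto simp: coord_image_def)
  show op: "open (coord_image \<phi> D)" using assms by (simp add: conical_region_def)
  fix i
  show "homogeneous_on 2 (coord_image \<phi> D) (G \<phi> i)"
    using assms homogeneous_on_subset[OF _ sub] by (simp add: spray_def)
  have L: "bounded_linear (\<lambda>z :: (real^'n) \<times> (real^'n). (-1/2) *\<^sub>R (snd z $ i))"
    by (intro bounded_linear_compose[OF bounded_linear_scaleR_right]
        bounded_linear_compose[OF bounded_linear_vec_nth] bounded_linear_snd)
  have "smooth_on (coord_image \<phi> C) (\<lambda>z. (snd z, \<chi> i. - 2 * G \<phi> i z))"
    using assms by (simp add: spray_def smooth_vector_field_on_def)
  from smooth_on_bounded_linear[OF L op smooth_on_subset[OF this sub]]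
  show "smooth_on (coord_image \<phi> D) (G \<phi> i)" by simp
qed

lemma scalar_spray_chart_coord_image:
  assumes "spray A C G" "scalar_curvature A C G R \<tau>" "\<phi> \<in> A" "conical_region A D" "D \<subseteq> C"
  shows "scalar_spray_chart (coord_image \<phi> D) (G \<phi>) (local_expr A \<phi> R) (\<tau> \<phi>)"
proof -
  interpret spray_chart "coord_image \<phi> D" "G \<phi>" by (rule spray_chart_coord_image) (use assms in auto)
  have sub: "coord_image \<phi> D \<subseteq> coord_image \<phi> C" using assms by (auto simp: coord_image_def)
  show ?thesis
    by unfold_locales
      (use assms(2,3) sub in \<open>auto simp: scalar_curvature_def intro: smooth_on_subset homogeneous_on_subset\<close>)
qed

lemma funk_chart_coord_image:
  assumes "spray A C G" "scalar_curvature A C G R \<tau>" "funk_function A C G Q"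
    "\<phi> \<in> A" "conical_region A D" "D \<subseteq> C"
  shows "funk_chart (coord_image \<phi> D) (G \<phi>) (local_expr A \<phi> R) (\<tau> \<phi>) (local_expr A \<phi> Q)"
proof -
  interpret scalar_spray_chart "coord_image \<phi> D" "G \<phi>" "local_expr A \<phi> R" "\<tau> \<phi>"
    by (rule scalar_spray_chart_coord_image) (use assms in auto)
  have sub: "coord_image \<phi> D \<subseteq> coord_image \<phi> C" using assms by (auto simp: coord_image_def)
  show ?thesis
    by unfold_locales
      (use assms(3,4) sub in \<open>auto simp: funk_function_def intro: smooth_on_subset homogeneous_on_subset\<close>)
qed

lemma coord_image_nonzero:
  assumes "smooth_atlas A" "\<phi> \<in> A" "D \<subseteq> tangent_bundle A" "\<forall>w\<in>D. R w \<noteq> 0" "z \<in> coord_image \<phi> D"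
  shows "local_expr A \<phi> R z \<noteq> 0"
proof -
  obtain w where w: "w \<in> D" "fst w \<in> fst \<phi>" "z = coords \<phi> w"
    using assms(5) by (auto simp: coord_image_def)
  then have "w \<in> tangent_bundle A" using assms(3) by auto
  from local_expr_coords[OF assms(1,2) this w(2)] show ?thesis using assms(4) w by auto
qed

lemma isotropic_funk_chart_coord_image:
  assumes "smooth_atlas A" "spray A C G" "isotropic_curvature A C G R \<tau>" "funk_function A C G Q"
    "\<phi> \<in> A" "conical_region A D" "D \<subseteq> C" "connected_fibres A D" "\<forall>w\<in>D. R w \<noteq> 0"
  shows "isotropic_funk_chart (coord_image \<phi> D) (G \<phi>) (local_expr A \<phi> R) (\<tau> \<phi>) (local_expr A \<phi> Q)"
proof -
  interpret funk_chart "coord_image \<phi> D" "G \<phi>" "local_expr A \<phi> R" "\<tau> \<phi>" "local_expr A \<phi> Q"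
    by (rule funk_chart_coord_image) (use assms in \<open>auto simp: isotropic_curvature_def\<close>)
  have sub: "coord_image \<phi> D \<subseteq> coord_image \<phi> C" using assms by (auto simp: coord_image_def)
  have D: "D \<subseteq> tangent_bundle A" using assms(6) by (auto simp: conical_region_def)
  show ?thesis
    by unfold_locales
      (use assms sub coord_image_nonzero[OF assms(1,5) D assms(9)]
        in \<open>auto simp: isotropic_curvature_def connected_fibres_def\<close>)
qed

lemma constant_funk_chart_coord_image:
  assumes "smooth_atlas A" "spray A C G" "constant_curvature A C G R \<tau>" "funk_function A C G Q"
    "\<phi> \<in> A" "conical_region A D" "D \<subseteq> C" "connected_fibres A D" "\<forall>w\<in>D. R w \<noteq> 0"
  shows "constant_funk_chart (coord_image \<phi> D) (G \<phi>) (local_expr A \<phi> R) (\<tau> \<phi>) (local_expr A \<phi> Q)"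
proof -
  interpret funk_chart "coord_image \<phi> D" "G \<phi>" "local_expr A \<phi> R" "\<tau> \<phi>" "local_expr A \<phi> Q"
    by (rule funk_chart_coord_image) (use assms in \<open>auto simp: constant_curvature_def\<close>)
  have sub: "coord_image \<phi> D \<subseteq> coord_image \<phi> C" using assms by (auto simp: coord_image_def)
  have D: "D \<subseteq> tangent_bundle A" using assms(6) by (auto simp: conical_region_def)
  show ?thesis
    by unfold_locales
      (use assms sub coord_image_nonzero[OF assms(1,5) D assms(9)]
        in \<open>auto simp: constant_curvature_def connected_fibres_def\<close>)
qed

text \<open>
  The function \<open>c\<close> on the base of \<open>D\<close>, defined through tangent vectors so that no chart is involved.
\<close>
definition curvature_ratio ::
    "('m, 'n) tvec set \<Rightarrow> (('m, 'n) tvec \<Rightarrow> real) \<Rightarrow> (('m, 'n) tvec \<Rightarrow> real) \<Rightarrow> 'm \<Rightarrow> real" where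
  "curvature_ratio D R Q p = (let w = SOME w. w \<in> D \<and> fst w = p in (Q w)\<^sup>2 / R w)"

text \<open>
  The value of \<open>Q\<^sup>2 / R\<close> at any tangent vector over a point is the value of \<open>base_ratio\<close> there, so the vector
  chosen by \<open>curvature_ratio\<close> is as good as any other.
\<close>
lemma curvature_ratio_chart:
  assumes at: "smooth_atlas A" and \<phi>: "\<phi> \<in> A" and D: "D \<subseteq> tangent_bundle A"
    and iso: "isotropic_funk_chart (coord_image \<phi> D) g (local_expr A \<phi> R) t (local_expr A \<phi> Q)"
    and w: "w \<in> D" "fst w \<in> fst \<phi>"
  shows "isotropic_funk_chart.base_ratio (coord_image \<phi> D) (local_expr A \<phi> R) (local_expr A \<phi> Q) (snd \<phi> (fst w))
      = curvature_ratio D R Q (fst w)" (is ?A)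
    and "curvature_ratio D R Q (fst w) = (Q w)\<^sup>2 / R w" (is ?B)
proof -
  interpret isotropic_funk_chart "coord_image \<phi> D" g "local_expr A \<phi> R" t "local_expr A \<phi> Q"
    by (rule iso)
  have base: "base_ratio (snd \<phi> (fst w)) = (Q w)\<^sup>2 / R w" if w: "w \<in> D" "fst w \<in> fst \<phi>" for w
  proof -
    have "coords \<phi> w = (snd \<phi> (fst w), snd w \<phi>)" by (simp add: coords_def case_prod_beta)
    then have "base_ratio (snd \<phi> (fst w)) = sq_ratio (coords \<phi> w)"
      using sq_ratio_eq_base_ratio coords_in_coord_image[of w D \<phi>] w by metis
    also have "\<dots> = (Q w)\<^sup>2 / R w"
      unfolding sq_ratio_def using local_expr_coords[OF at \<phi>, of w] w D by (auto simp: power2_eq_square)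
    finally show ?thesis .
  qed
  define w' where "w' = (SOME w'. w' \<in> D \<and> fst w' = fst w)"
  have "w' \<in> D \<and> fst w' = fst w" unfolding w'_def by (rule someI[of _ w]) (use w in simp)
  then have "base_ratio (snd \<phi> (fst w)) = (Q w')\<^sup>2 / R w'" using base[of w'] w by simp
  then show ?A by (simp add: curvature_ratio_def w'_def Let_def)
  then show ?B using base[OF w] by simp
qed

section \<open>The relations between \<open>R\<close>, \<open>\<tau>\<close> and \<open>Q\<close>\<close>

lemma isotropic_imp_ratio:
  assumes at: "smooth_atlas A" and "spray A C G" "isotropic_curvature A C G R \<tau>" "funk_function A C G Q"
    "conical_region A D" "D \<subseteq> C" "connected_fibres A D" "\<forall>w\<in>D. R w \<noteq> 0"
  shows "\<exists>c. smooth_fun_on A (fst ` D) c \<and> (\<forall>(p, v)\<in>D. (Q (p, v))\<^sup>2 = c p * R (p, v))"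
proof (intro exI conjI)
  note iso = isotropic_funk_chart_coord_image[OF assms(1-4) _ assms(5-8)]
  have D: "D \<subseteq> tangent_bundle A" using assms(5) by (auto simp: conical_region_def)
  note ratio = curvature_ratio_chart[OF at _ D]
  show "smooth_fun_on A (fst ` D) (curvature_ratio D R Q)"
    unfolding smooth_fun_on_def
  proof
    fix \<phi> assume \<phi>: "\<phi> \<in> A"
    interpret isotropic_funk_chart "coord_image \<phi> D" "G \<phi>" "local_expr A \<phi> R" "\<tau> \<phi>" "local_expr A \<phi> Q"
      by (rule iso[OF \<phi>])
    show "smooth_on (snd \<phi> ` (fst \<phi> \<inter> fst ` D)) (curvature_ratio D R Q \<circ> chart_inv \<phi>)"
      by (rule smooth_on_cong[OF smooth_base_ratio open_base, unfolded fst_coord_image])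
        (use ratio(1)[OF \<phi> iso[OF \<phi>]] chart_inv_chart[OF at \<phi>] in auto)
  qed
  show "\<forall>(p, v)\<in>D. (Q (p, v))\<^sup>2 = curvature_ratio D R Q p * R (p, v)"
  proof clarify
    fix p v assume w: "(p, v) \<in> D"
    obtain \<phi> where \<phi>: "\<phi> \<in> A" "p \<in> fst \<phi>" using at unfolding smooth_atlas_def by blast
    show "(Q (p, v))\<^sup>2 = curvature_ratio D R Q p * R (p, v)"
      using ratio(2)[OF \<phi>(1) iso[OF \<phi>(1)] w] \<phi> w assms(8) by simp
  qed
qed

lemma constant_imp_closed_one_form:
  assumes at: "smooth_atlas A" and "spray A C G" "constant_curvature A C G R \<tau>" "funk_function A C G Q"
    "conical_region A D" "D \<subseteq> C" "connected_fibres A D" "\<forall>w\<in>D. R w \<noteq> 0"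
  shows "closed_one_form_on A D Q"
  unfolding closed_one_form_on_def
proof
  fix \<phi> assume \<phi>: "\<phi> \<in> A"
  interpret constant_funk_chart "coord_image \<phi> D" "G \<phi>" "local_expr A \<phi> R" "\<tau> \<phi>" "local_expr A \<phi> Q"
    by (rule constant_funk_chart_coord_image[OF assms(1-4) \<phi> assms(5-8)])
  show "\<exists>b :: real^'b \<Rightarrow> real^'b.
        smooth_on (snd \<phi> ` (fst \<phi> \<inter> fst ` D)) b \<and>
        (\<forall>(x, y)\<in>coord_image \<phi> D. local_expr A \<phi> Q (x, y) = (\<Sum>i\<in>UNIV. b x $ i * y $ i)) \<and>
        (\<forall>x\<in>snd \<phi> ` (fst \<phi> \<inter> fst ` D). \<forall>i j.
           frechet_derivative b (at x) (axis j 1) $ i = frechet_derivative b (at x) (axis i 1) $ j)"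
    unfolding fst_coord_image[symmetric]
    using smooth_form_coeff Q_eq_form form_coeff_closed by blast
qed

text \<open>
  With \<open>s\<close> the constant sign of \<open>c\<close>, the potential is \<open>\<sigma> = ln (s c) / 2\<close>: from \<open>dc = 2 c b\<close> its differential is
  \<open>b\<close>, and \<open>exp (2 \<sigma>) = s c\<close> turns \<open>Q\<^sup>2 = c R\<close> into the other two formulas.
\<close>
lemma constant_imp_exact:
  assumes at: "smooth_atlas A" and "spray A C G" "constant_curvature A C G R \<tau>" "funk_function A C G Q"
    "conical_region A D" "D \<subseteq> C" "connected_fibres A D" and R: "\<forall>w\<in>D. R w \<noteq> 0"
    and conn: "connected (fst ` D)" and Qw: "\<exists>w\<in>D. Q w \<noteq> 0"
  shows "\<exists>\<sigma>. smooth_fun_on A (fst ` D) \<sigma> \<and>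
     (\<exists>s\<in>{1, -1}. \<forall>\<phi>\<in>A. \<forall>(p, v)\<in>D. p \<in> fst \<phi> \<longrightarrow>
        Q (p, v) = total_deriv \<phi> \<sigma> (p, v) \<and>
        R (p, v) = s * (total_deriv \<phi> (\<lambda>q. exp (- \<sigma> q)) (p, v))\<^sup>2 \<and>
        (Q (p, v))\<^sup>2 = s * exp (2 * \<sigma> p) * R (p, v))"
proof -
  let ?c = "curvature_ratio D R Q"
  note con = constant_funk_chart_coord_image[OF assms(1-4) _ assms(5-8)]
  have iso: "isotropic_funk_chart (coord_image \<phi> D) (G \<phi>) (local_expr A \<phi> R) (\<tau> \<phi>) (local_expr A \<phi> Q)"
    if \<phi>: "\<phi> \<in> A" for \<phi>
  proof -
    interpret constant_funk_chart "coord_image \<phi> D" "G \<phi>" "local_expr A \<phi> R" "\<tau> \<phi>" "local_expr A \<phi> Q"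
      by (rule con[OF \<phi>])
    show ?thesis by unfold_locales
  qed
  have D: "D \<subseteq> tangent_bundle A" using assms(5) by (auto simp: conical_region_def)
  note ratio = curvature_ratio_chart[OF at _ D]
  have sgn_const: "sgn (?c p) = sgn (?c q)" if "p \<in> fst ` D" "q \<in> fst ` D" for p q
  \<comment> \<open>The open level sets of the sign in a chart are pulled back to the manifold.\<close>
  proof (rule connected_local_const[where f="\<lambda>p. sgn (?c p)", OF conn that], rule ballI)
    fix p assume p: "p \<in> fst ` D"
    obtain \<phi> where \<phi>: "\<phi> \<in> A" "p \<in> fst \<phi>" using at unfolding smooth_atlas_def by blast
    interpret constant_funk_chart "coord_image \<phi> D" "G \<phi>" "local_expr A \<phi> R" "\<tau> \<phi>" "local_expr A \<phi> Q"
      by (rule con[OF \<phi>(1)])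
    let ?S = "{x \<in> fst ` coord_image \<phi> D. sgn (base_ratio x) = sgn (?c p)}"
    let ?T = "fst \<phi> \<inter> snd \<phi> -` ?S"
    have "open (fst \<phi>)" "continuous_on (fst \<phi>) (snd \<phi>)"
      using at \<phi>(1) homeomorphism_cont1 unfolding smooth_atlas_def by blast+
    then have "open ?T" by (intro continuous_open_preimage open_sgn_base_ratio)
    moreover have cr: "base_ratio (snd \<phi> q) = ?c q" if "q \<in> fst ` D" "q \<in> fst \<phi>" for q
      using ratio(1)[OF \<phi>(1) iso[OF \<phi>(1)]] that by auto
    have "p \<in> ?T" using p \<phi> cr by (auto simp: fst_coord_image)
    moreover have "sgn (?c p) = sgn (?c q)" if "q \<in> ?T" for q
    proof -
      have "snd \<phi> q \<in> snd \<phi> ` (fst \<phi> \<inter> fst ` D)"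
        using that unfolding fst_coord_image by blast
      then obtain q' where q': "q' \<in> fst \<phi>" "q' \<in> fst ` D" "snd \<phi> q = snd \<phi> q'" by blast
      have "q \<in> fst \<phi>" and sgn: "sgn (base_ratio (snd \<phi> q)) = sgn (?c p)" using that by blast+
      then have "q = chart_inv \<phi> (snd \<phi> q')"
        using chart_inv_chart[OF at \<phi>(1)] by (simp only: q'(3)[symmetric])
      also have "\<dots> = q'" by (rule chart_inv_chart[OF at \<phi>(1) q'(1)])
      finally have q: "q = q'" .
      show ?thesis using sgn cr[OF q'(2,1)] unfolding q by (simp only:)
    qed
    ultimately show "eventually (\<lambda>q. sgn (?c p) = sgn (?c q)) (at p within fst ` D)"
      unfolding eventually_at_topological by blast
  qed
  have QR: "(Q w)\<^sup>2 = ?c (fst w) * R w" if w: "w \<in> D" for w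
  proof -
    obtain \<phi> where \<phi>: "\<phi> \<in> A" "fst w \<in> fst \<phi>" using at unfolding smooth_atlas_def by blast
    show ?thesis using ratio(2)[OF \<phi>(1) iso[OF \<phi>(1)] w \<phi>(2)] R w by simp
  qed
  obtain w0 where w0: "w0 \<in> D" "Q w0 \<noteq> 0" using Qw by blast
  define s where "s = sgn (?c (fst w0))"
  have "?c (fst w0) \<noteq> 0" using QR[OF w0(1)] w0(2) by auto
  then have s: "s \<in> {1, -1}" by (auto simp: s_def sgn_if)
  then have ss: "s * s = 1" by auto
  have pos: "0 < s * ?c p" if "p \<in> fst ` D" for p
  proof -
    have "sgn (?c p) = s" using sgn_const[OF that imageI[OF w0(1)]] by (simp add: s_def)
    then show ?thesis using s by (auto simp: sgn_if split: if_splits)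
  qed
  define \<sigma> where "\<sigma> p = ln (s * ?c p) / 2" for p
  have exp\<sigma>: "exp (2 * \<sigma> p) = s * ?c p" if "p \<in> fst ` D" for p
    using pos[OF that] by (simp add: \<sigma>_def)
  have chart: "smooth_on (snd \<phi> ` (fst \<phi> \<inter> fst ` D)) (\<sigma> \<circ> chart_inv \<phi>) \<and>
      (\<forall>p v. (p, v) \<in> D \<and> p \<in> fst \<phi> \<longrightarrow> Q (p, v) = total_deriv \<phi> \<sigma> (p, v) \<and>
        total_deriv \<phi> (\<lambda>q. exp (- \<sigma> q)) (p, v) = - exp (- \<sigma> p) * Q (p, v))" if \<phi>: "\<phi> \<in> A" for \<phi>
  proof -
    interpret constant_funk_chart "coord_image \<phi> D" "G \<phi>" "local_expr A \<phi> R" "\<tau> \<phi>" "local_expr A \<phi> Q"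
      by (rule con[OF \<phi>])
    let ?B = "fst ` coord_image \<phi> D"
    have cr: "base_ratio x = ?c (chart_inv \<phi> x)" and inD: "chart_inv \<phi> x \<in> fst ` D" if "x \<in> ?B" for x
      using that ratio(1)[OF \<phi> iso[OF \<phi>]] chart_inv_chart[OF at \<phi>] unfolding fst_coord_image by auto
    have cpos: "0 < s * base_ratio x" if "x \<in> ?B" for x using pos[OF inD[OF that]] cr[OF that] by simp
    have \<sigma>base_ratio: "(1/2) * ln (s * base_ratio x) = (\<sigma> \<circ> chart_inv \<phi>) x" if "x \<in> ?B" for x
      using cr[OF that] by (simp add: \<sigma>_def)
    have "smooth_on ?B (\<lambda>x. (1/2) * ln (s * base_ratio x))"
      by (rule smooth_on_bounded_linear[OF bounded_linear_mult_right open_base],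
          rule smooth_on_ln[OF cpos open_base],
          assumption, rule smooth_on_bounded_linear[OF bounded_linear_mult_right open_base smooth_base_ratio])
    then have sm: "smooth_on ?B (\<sigma> \<circ> chart_inv \<phi>)" by (rule smooth_on_cong[OF _ open_base \<sigma>base_ratio])
    have der: "((\<sigma> \<circ> chart_inv \<phi>) has_derivative (\<lambda>h. form_coeff x \<bullet> h)) (at x)" if x: "x \<in> ?B" for x
    proof (rule has_derivative_transform_within_open[OF _ open_base x \<sigma>base_ratio])
      have "base_ratio x \<noteq> 0" using cpos[OF x] by auto
      then show "((\<lambda>x. (1/2) * ln (s * base_ratio x)) has_derivative (\<lambda>h. form_coeff x \<bullet> h)) (at x)"
        using cpos[OF x] s
        by (auto intro!: derivative_eq_intros base_ratio_derivative[OF x] simp: field_simps)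
    qed
    have "Q (p, v) = total_deriv \<phi> \<sigma> (p, v) \<and>
        total_deriv \<phi> (\<lambda>q. exp (- \<sigma> q)) (p, v) = - exp (- \<sigma> p) * Q (p, v)"
      if w: "(p, v) \<in> D" "p \<in> fst \<phi>" for p v
    proof -
      have z: "(snd \<phi> p, v \<phi>) \<in> coord_image \<phi> D"
        using coords_in_coord_image[OF w(1), of \<phi>] w by (simp add: coords_def)
      then have x: "snd \<phi> p \<in> ?B" by force
      have Q: "Q (p, v) = (\<Sum>i\<in>UNIV. form_coeff (snd \<phi> p) $ i * v \<phi> $ i)"
        using Q_eq_form[OF z] local_expr_coords[OF at \<phi>, of "(p, v)" Q] w D by (auto simp: coords_def)
      have "frechet_derivative (\<sigma> \<circ> chart_inv \<phi>) (at (snd \<phi> p)) = (\<lambda>h. form_coeff (snd \<phi> p) \<bullet> h)"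
        by (rule frechet_derivative_at[OF der[OF x], symmetric])
      then have 1: "total_deriv \<phi> \<sigma> (p, v) = Q (p, v)"
        by (simp add: total_deriv_def Q inner_axis)
      have "(((\<lambda>q. exp (- \<sigma> q)) \<circ> chart_inv \<phi>) has_derivative
          (\<lambda>h. exp (- (\<sigma> \<circ> chart_inv \<phi>) (snd \<phi> p)) * - (form_coeff (snd \<phi> p) \<bullet> h))) (at (snd \<phi> p))"
        unfolding o_def
        by (rule derivative_eq_intros der[OF x, unfolded o_def] refl)+ (simp add: mult.commute)
      from frechet_derivative_at[OF this, symmetric]
      have "frechet_derivative ((\<lambda>q. exp (- \<sigma> q)) \<circ> chart_inv \<phi>) (at (snd \<phi> p))
          = (\<lambda>h. exp (- \<sigma> p) * - (form_coeff (snd \<phi> p) \<bullet> h))"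
        using chart_inv_chart[OF at \<phi> w(2)] by simp
      then have "total_deriv \<phi> (\<lambda>q. exp (- \<sigma> q)) (p, v) = - exp (- \<sigma> p) * Q (p, v)"
        by (simp add: total_deriv_def Q inner_axis sum_distrib_left sum_negf mult.assoc)
      with 1 show ?thesis by simp
    qed
    with sm show ?thesis by (simp add: fst_coord_image)
  qed
  have "R (p, v) = s * (exp (- \<sigma> p) * Q (p, v))\<^sup>2 \<and> (Q (p, v))\<^sup>2 = s * exp (2 * \<sigma> p) * R (p, v)"
    if w: "(p, v) \<in> D" for p v
  proof -
    have p: "p \<in> fst ` D" using w by force
    have Q: "(Q (p, v))\<^sup>2 = s * exp (2 * \<sigma> p) * R (p, v)"
      using QR[OF w] ss by (simp add: exp\<sigma>[OF p] mult.assoc[symmetric])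
    have "s * (exp (- \<sigma> p) * Q (p, v))\<^sup>2 = (s * s) * (exp (- \<sigma> p) ^ 2 * exp (2 * \<sigma> p)) * R (p, v)"
      unfolding power_mult_distrib Q by (simp add: mult_ac)
    also have "exp (- \<sigma> p) ^ 2 * exp (2 * \<sigma> p) = 1"
      by (simp add: power2_eq_square exp_add[symmetric])
    finally show ?thesis using Q ss by simp
  qed
  then show ?thesis
    using chart s by (intro exI[of _ \<sigma>] conjI bexI[of _ s]) (auto simp: smooth_fun_on_def power2_minus)
qed

theorem proposition5p5:
  fixes A :: "('m::{t2_space, second_countable_topology}, 'n::finite) chart set"
    and C :: "('m, 'n) tvec set"
    and G :: "('m, 'n) chart \<Rightarrow> 'n \<Rightarrow> (real^'n) \<times> (real^'n) \<Rightarrow> real"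
    and R Q :: "('m, 'n) tvec \<Rightarrow> real"
    and \<tau> :: "('m, 'n) chart \<Rightarrow> 'n \<Rightarrow> (real^'n) \<times> (real^'n) \<Rightarrow> real"
  assumes "smooth_atlas A"
    and "spray A C G"
    and "scalar_curvature A C G R \<tau>"
    and "funk_function A C G Q"
  shows
    "(\<forall>\<phi>\<in>A. \<forall>z\<in>coord_image \<phi> C. \<forall>k.
        local_expr A \<phi> R z * pdy k (local_expr A \<phi> Q) z = local_expr A \<phi> Q z * \<tau> \<phi> k z) \<and>
     (isotropic_curvature A C G R \<tau> \<longrightarrow>
        (\<forall>D. conical_region A D \<and> D \<subseteq> C \<and> connected_fibres A D \<and> (\<forall>w\<in>D. R w \<noteq> 0) \<longrightarrow>
           (\<exists>c. smooth_fun_on A (fst ` D) c \<and> (\<forall>(p, v)\<in>D. (Q (p, v))\<^sup>2 = c p * R (p, v))))) \<and>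
     (constant_curvature A C G R \<tau> \<longrightarrow>
        (\<forall>D. conical_region A D \<and> D \<subseteq> C \<and> connected_fibres A D \<and> (\<forall>w\<in>D. R w \<noteq> 0) \<longrightarrow>
           closed_one_form_on A D Q \<and>
           (connected (fst ` D) \<and> (\<exists>w\<in>D. Q w \<noteq> 0) \<longrightarrow>
              (\<exists>\<sigma>. smooth_fun_on A (fst ` D) \<sigma> \<and>
                (\<exists>s\<in>{1, -1}. \<forall>\<phi>\<in>A. \<forall>(p, v)\<in>D. p \<in> fst \<phi> \<longrightarrow>
                   Q (p, v) = total_deriv \<phi> \<sigma> (p, v) \<and>
                   R (p, v) = s * (total_deriv \<phi> (\<lambda>q. exp (- \<sigma> q)) (p, v))\<^sup>2 \<and>
                   (Q (p, v))\<^sup>2 = s * exp (2 * \<sigma> p) * R (p, v))))))"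
proof (intro conjI impI allI ballI, goal_cases)
  case (1 \<phi> z k)
  have C: "conical_region A C" using assms(2) by (simp add: spray_def)
  interpret funk_chart "coord_image \<phi> C" "G \<phi>" "local_expr A \<phi> R" "\<tau> \<phi>" "local_expr A \<phi> Q"
    by (rule funk_chart_coord_image[OF assms(2-4) 1(1) C subset_refl])
  show ?case by (rule R_pdy_Q[OF 1(2)])
next
  case (2 D)
  then show ?case using isotropic_imp_ratio[OF assms(1,2) _ assms(4)] by blast
next
  case (3 D)
  then show ?case using constant_imp_closed_one_form[OF assms(1,2) _ assms(4)] by blast
next
  case (4 D)
  then show ?case by (intro constant_imp_exact[OF assms(1,2) _ assms(4)]) auto
qed

end
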